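(* Let $A\in\mathbb{R}^{n\times n}$ be symmetric positive definite with eigenvalues $\lambda_1\le\cdots\le\lambda_n$, let $\mathcal K\subset\mathbb{R}^n$ be a subspace, and let $u_1^{(\ell)},\dots,u_k^{(\ell)}\in\mathbb{R}^n$ be given eigenvector approximations. Let $u_1^{(\ell+1)},\dots,u_k^{(\ell+1)}$ be the output of one step of the inverse power method on the subspace $\mathcal K_k^{(\ell+1)}:=\mathcal K+\mathrm{span}\{u_1^{(\ell)},\dots,u_k^{(\ell)}\}$ (described in the context). Let $m:=\dim\mathcal K_k^{(\ell+1)}$, assume $k<m$, and set $\mu_i=1/\lambda_i$, $\mu_i^{(\ell+1)}=1/\lambda_i^{(\ell+1)}$ for $i=1,\dots,m$, and $$\delta_{k,i}^{(\ell+1)}:=\min_{k<j\le m}|\mu_j^{(\ell+1)}-\mu_i|,\quad i=1,\dots,k,$$ assumed positive. Define $$\theta_{\mathcal K_k^{(\ell+1)}}:=\sqrt{1+\frac{\mu_{k+1}^{(\ell+1)}\,\eta_{\mathcal K_k^{(\ell+1)}}^2}{\big(\delta_{k,k}^{(\ell+1)}\big)^2}},\qquad \eta_{\mathcal K_k^{(\ell+1)},k,i}:=\Big(1+\frac{\mu_{k+1}^{(\ell+1)}}{\delta_{k,i}^{(\ell+1)}}\Big)\eta_{\mathcal K_k^{(\ell+1)}},\quad i=1,\dots,k .$$ Then there exist exact eigenvectors $u_1,\dots,u_k$ of $A$, with $Au_i=\lambda_iu_i$ and $(u_i,u_j)_A=\delta_{ij}$ (Kronecker delta), such that $$\Big(\sum_{i=1}^k\|u_i-E_{m,k}^{(\ell+1)}u_i\|_A^2\Big)^{1/2}\le\theta_{\mathcal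 K_k^{(\ell+1)}}\sqrt{\frac{\lambda_k}{\lambda_{k+1}}}\Big(\sqrt{\lambda_k^{(\ell+1)}}\,\eta_{\mathcal K_k^{(\ell+1)},k,k}\Big)\Big(\sum_{i=1}^k\|u_i-E_{m,k}^{(\ell)}u_i\|_A^2\Big)^{1/2}.$$
   Context: For $x,y\in\mathbb{R}^n$: $(x,y)=x^Ty$, $(x,y)_A=x^TAy$, $\|x\|_2=\sqrt{(x,x)}$, $\|x\|_A=\sqrt{(x,x)_A}$. For a subspace $\mathcal W\subset\mathbb{R}^n$, $\mathcal P_{\mathcal W}:\mathbb{R}^n\to\mathcal W$ is the $A$-orthogonal projection, $(\mathcal P_{\mathcal W}x,y)_A=(x,y)_A$ for all $x\in\mathbb{R}^n$, $y\in\mathcal W$, and $$\eta_{\mathcal W}:=\sup_{\|g\|_2=1}\|(I-\mathcal P_{\mathcal W})A^{-1}g\|_A .$$ One step of the inverse power method on a subspace: given $u_1^{(\ell)},\dots,u_k^{(\ell)}$, (1) form $\mathcal K_k^{(\ell+1)}=\mathcal K+\mathrm{span}\{u_1^{(\ell)},\dots,u_k^{(\ell)}\}$ and solve the eigenvalue problem: find $\widetilde u_i^{(\ell+1)}\in\mathcal K_k^{(\ell+1)}$ and $\lambda_i^{(\ell+1)}\in\mathbb{R}$ such that $\|\widetilde u_i^{(\ell+1)}\|_A=1$ and $(A\widetilde u_i^{(\ell+1)},v)=\lambda_i^{(\ell+1)}(\widetilde u_i^{(\ell+1)},v)$ for all $v\in\mathcal K_k^{(\ell+1)}$; the eigenvalues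 are ordered $\lambda_1^{(\ell+1)}\le\cdots\le\lambda_m^{(\ell+1)}$ (with multiplicity, $m=\dim\mathcal K_k^{(\ell+1)}$), the eigenvectors are chosen $A$-orthonormal, and the first $k$ of them, $\widetilde u_1^{(\ell+1)},\dots,\widetilde u_k^{(\ell+1)}$, are kept; (2) solve the linear equations $Au_i^{(\ell+1)}=\lambda_i^{(\ell+1)}\widetilde u_i^{(\ell+1)}$, $i=1,\dots,k$. The output is $u_1^{(\ell+1)},\dots,u_k^{(\ell+1)}$. $E_{m,k}^{(\ell)}$ and $E_{m,k}^{(\ell+1)}$ are the $A$-orthogonal projections of $\mathbb{R}^n$ onto $\mathrm{span}\{u_1^{(\ell)},\dots,u_k^{(\ell)}\}$ and $\mathrm{span}\{u_1^{(\ell+1)},\dots,u_k^{(\ell+1)}\}$ respectively, e.g. $(E_{m,k}^{(\ell)}w,u_i^{(\ell)})_A=(w,u_i^{(\ell)})_A$ for all $w\in\mathbb{R}^n$, $i=1,\dots,k$. *)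

theory Defs
  imports "HOL-Analysis.Analysis"
begin

definition spd :: "real^'n^'n \<Rightarrow> bool" where
  "spd A \<longleftrightarrow> transpose A = A \<and> (\<forall>x. x \<noteq> 0 \<longrightarrow> x \<bullet> (A *v x) > 0)"

text \<open>The eigenvalues \<open>lam 1 \<le> \<dots> \<le> lam n\<close> with multiplicity are the roots of the
  characteristic polynomial; values of \<open>lam\<close> outside \<open>{1..n}\<close> are irrelevant.\<close>

definition ordered_eigenvalues :: "real^'n^'n \<Rightarrow> (nat \<Rightarrow> real) \<Rightarrow> bool" where
  "ordered_eigenvalues A lam \<longleftrightarrow>
     mono_on {1..CARD('n)} lam \<and>
     (\<forall>t. det (mat t - A) = (\<Prod>i = 1..CARD('n). t - lam i))"

definition ip_A :: "real^'n^'n \<Rightarrow> real^'n \<Rightarrow> real^'n \<Rightarrow> real" where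
  "ip_A A x y = x \<bullet> (A *v y)"

definition norm_A :: "real^'n^'n \<Rightarrow> real^'n \<Rightarrow> real" where
  "norm_A A x = sqrt (ip_A A x x)"

text \<open>The \<open>A\<close>-orthogonal projection onto \<open>W\<close>; the description is unique when \<open>A\<close> is
  symmetric positive definite and \<open>W\<close> is a subspace.\<close>

definition proj_A :: "real^'n^'n \<Rightarrow> (real^'n) set \<Rightarrow> real^'n \<Rightarrow> real^'n" where
  "proj_A A W x = (THE p. p \<in> W \<and> (\<forall>y\<in>W. ip_A A p y = ip_A A x y))"

definition eta :: "real^'n^'n \<Rightarrow> (real^'n) set \<Rightarrow> real" where
  "eta A W = (SUP g\<in>{g. norm g = 1}.
     norm_A A (matrix_inv A *v g - proj_A A W (matrix_inv A *v g)))"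

definition aug_space :: "(real^'n) set \<Rightarrow> nat \<Rightarrow> (nat \<Rightarrow> real^'n) \<Rightarrow> (real^'n) set" where
  "aug_space K k u = {x + y | x y. x \<in> K \<and> y \<in> span (u ` {1..k})}"

text \<open>A full \<open>A\<close>-orthonormal system of \<open>dim W\<close> Ritz pairs on \<open>W\<close>, so that the
  Ritz values \<open>rv\<close> are automatically listed with multiplicity.\<close>

definition ritz_pairs ::
    "real^'n^'n \<Rightarrow> (real^'n) set \<Rightarrow> (nat \<Rightarrow> real) \<Rightarrow> (nat \<Rightarrow> real^'n) \<Rightarrow> bool" where
  "ritz_pairs A W rv w \<longleftrightarrow>
     mono_on {1..dim W} rv \<and>
     (\<forall>i\<in>{1..dim W}. w i \<in> W) \<and>
     (\<forall>i\<in>{1..dim W}. \<forall>j\<in>{1..dim W}. ip_A A (w i) (w j) = (if i = j then 1 else 0)) \<and>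
     (\<forall>i\<in>{1..dim W}. \<forall>v\<in>W. (A *v w i) \<bullet> v = rv i * (w i \<bullet> v))"

text \<open>One step of the inverse power method on a subspace: input \<open>u\<close>, Ritz pairs
  \<open>(rv, w)\<close> on the augmented space, output \<open>u'\<close>.\<close>

definition inverse_power_step ::
    "real^'n^'n \<Rightarrow> (real^'n) set \<Rightarrow> nat \<Rightarrow> (nat \<Rightarrow> real^'n) \<Rightarrow>
     (nat \<Rightarrow> real) \<Rightarrow> (nat \<Rightarrow> real^'n) \<Rightarrow> (nat \<Rightarrow> real^'n) \<Rightarrow> bool" where
  "inverse_power_step A K k u rv w u' \<longleftrightarrow>
     ritz_pairs A (aug_space K k u) rv w \<and>
     (\<forall>i\<in>{1..k}. A *v u' i = rv i *\<^sub>R w i)"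

text \<open>In the next three constants \<open>mu\<close> stands for the reciprocals of the exact eigenvalues,
  \<open>rmu\<close> for the reciprocals of the Ritz values and \<open>e\<close> for \<open>eta A W\<close>.\<close>

definition gap :: "(nat \<Rightarrow> real) \<Rightarrow> (nat \<Rightarrow> real) \<Rightarrow> nat \<Rightarrow> nat \<Rightarrow> nat \<Rightarrow> real" where
  "gap mu rmu m k i = (MIN j\<in>{k<..m}. \<bar>rmu j - mu i\<bar>)"

definition theta :: "(nat \<Rightarrow> real) \<Rightarrow> (nat \<Rightarrow> real) \<Rightarrow> nat \<Rightarrow> nat \<Rightarrow> real \<Rightarrow> real" where
  "theta mu rmu m k e = sqrt (1 + rmu (k + 1) * e\<^sup>2 / (gap mu rmu m k k)\<^sup>2)"

definition eta_ki :: "(nat \<Rightarrow> real) \<Rightarrow> (nat \<Rightarrow> real) \<Rightarrow> nat \<Rightarrow> nat \<Rightarrow> real \<Rightarrow> nat \<Rightarrow> real" where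
  "eta_ki mu rmu m k e i = (1 + rmu (k + 1) / gap mu rmu m k i) * e"

end

theory Submission
  imports Defs
begin

text \<open>
  Let \<open>v\<^sub>1, \<dots>, v\<^sub>n\<close> be energy-orthonormal eigenvectors, let \<open>w\<^sub>j\<close> be the Ritz vectors in
  \<open>W\<close>, let \<open>P\<close> be the energy-orthogonal projection onto \<open>W\<close> and \<open>Q\<close> the one onto the span of
  \<open>w\<^sub>1, \<dots>, w\<^sub>k\<close>. Any choice of the \<open>v\<^sub>i\<close> with the prescribed eigenvalues works. The estimate combines
  a gain from the linear solve with a gain from passing to the Euclidean norm.

  The sum of the squared errors on the left is the sum of the squared sines of the angles between the
  exact space, spanned by \<open>v\<^sub>1, \<dots>, v\<^sub>k\<close>, and the computed space. It does not change if the two spaces are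
  exchanged, so it can be expressed by how much the computed space contains of the unwanted
  eigenvectors \<open>v\<^sub>l\<close>, \<open>l > k\<close> (\<open>sum_norm_diff_projection_le\<close>). On these, applying
  the inverse of \<open>A\<close> damps by \<open>1 / lam l \<le> 1 / lam (k + 1)\<close>, while the right-hand sides of the
  linear equations carry the factors \<open>rlam i \<le> rlam k\<close>. After extracting these factors, the same exchange of spaces
  in the Euclidean inner product goes back to the wanted eigenvectors. The left-hand side
  squared is thus at most \<open>rlam k / lam (k + 1)\<close> times the sum over \<open>i \<le> k\<close> of \<open>lam i\<close> times the
  squared Euclidean norm of \<open>v\<^sub>i - Q v\<^sub>i\<close> (\<open>inverse_power_output_error\<close>).

  It remains to bound these Euclidean norms by energy norms. The component of \<open>v\<^sub>i\<close> along \<open>w\<^sub>j\<close>, times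
  \<open>1 / lam i - 1 / rlam j\<close>, is the Euclidean product of \<open>v\<^sub>i - P v\<^sub>i\<close> with \<open>w\<^sub>j\<close>. Summing over
  \<open>j > k\<close> shows that the Euclidean norm of \<open>v\<^sub>i - Q v\<^sub>i\<close> exceeds that of \<open>v\<^sub>i - P v\<^sub>i\<close> at most by a factor
  depending on the gap (\<open>norm_diff_ritz_truncation_le\<close>). A duality argument (\<open>Aubin_Nitsche\<close>) bounds the Euclidean
  norm of \<open>v\<^sub>i - P v\<^sub>i\<close> by \<open>eta\<close> times its energy norm. As \<open>W\<close> contains the old span, that
  energy norm is at most the error of the old iterate. Finally, \<open>lam (k + 1) \<le> rlam (k + 1)\<close>
  (\<open>ritz_value_ge\<close>) makes the gap at \<open>k\<close> the smallest, so that the constant for \<open>i = k\<close> covers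
  all \<open>i\<close>, and \<open>theta\<close> is at least 1.
\<close>

section \<open>Orthonormal families\<close>

definition orthonormal_family :: "'i set \<Rightarrow> ('i \<Rightarrow> 'a::real_inner) \<Rightarrow> bool" where
  "orthonormal_family I f \<longleftrightarrow> (\<forall>i\<in>I. \<forall>j\<in>I. f i \<bullet> f j = (if i = j then 1 else 0))"

lemma orthonormal_familyD:
  "orthonormal_family I f \<Longrightarrow> i \<in> I \<Longrightarrow> j \<in> I \<Longrightarrow> f i \<bullet> f j = (if i = j then 1 else 0)"
  unfolding orthonormal_family_def by blast

lemma orthonormal_family_subset:
  "orthonormal_family I f \<Longrightarrow> J \<subseteq> I \<Longrightarrow> orthonormal_family J f"
  unfolding orthonormal_family_def by blast

lemma orthonormal_family_inner_sum:
  assumes "finite I" "orthonormal_family I f" "j \<in> I"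
  shows "(\<Sum>i\<in>I. c i *\<^sub>R f i) \<bullet> f j = c j"
proof -
  have "(\<Sum>i\<in>I. c i *\<^sub>R f i) \<bullet> f j = (\<Sum>i\<in>I. if i = j then c i else 0)"
    unfolding inner_sum_left
    by (rule sum.cong) (use assms(3) orthonormal_familyD[OF assms(2)] in auto)
  then show ?thesis using assms by simp
qed

lemma norm_orthonormal_sum:
  assumes "finite I" "orthonormal_family I f"
  shows "(norm (\<Sum>i\<in>I. c i *\<^sub>R f i))\<^sup>2 = (\<Sum>i\<in>I. (c i)\<^sup>2)"
  unfolding power2_norm_eq_inner inner_sum_right[of "sum _ _"] inner_scaleR_right
  using orthonormal_family_inner_sum[OF assms] by (simp add: power2_eq_square)

text \<open>One identity serves two purposes: with \<open>c i = x \<bullet> f i\<close> the last sum vanishes and Bessel's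
  inequality follows; for arbitrary \<open>c\<close> it bounds from below the distance of \<open>x\<close> to every
  element of the span.\<close>

lemma norm_diff_orthonormal_sum:
  assumes "finite I" "orthonormal_family I f"
  shows "(norm (x - (\<Sum>i\<in>I. c i *\<^sub>R f i)))\<^sup>2
    = (norm x)\<^sup>2 - (\<Sum>i\<in>I. (x \<bullet> f i)\<^sup>2) + (\<Sum>i\<in>I. (x \<bullet> f i - c i)\<^sup>2)"
proof -
  let ?s = "\<Sum>i\<in>I. c i *\<^sub>R f i"
  have s: "?s \<bullet> ?s = (\<Sum>i\<in>I. (c i)\<^sup>2)"
    using norm_orthonormal_sum[OF assms] by (simp add: power2_norm_eq_inner)
  have x: "x \<bullet> ?s = (\<Sum>i\<in>I. (x \<bullet> f i) * c i)"
    by (simp add: inner_sum_right mult.commute)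
  have "(norm (x - ?s))\<^sup>2 = (norm x)\<^sup>2 - 2 * (x \<bullet> ?s) + ?s \<bullet> ?s"
    by (simp only: power2_norm_eq_inner) (simp add: inner_diff inner_commute)
  also have "\<dots> = (norm x)\<^sup>2 - (\<Sum>i\<in>I. (x \<bullet> f i)\<^sup>2) + (\<Sum>i\<in>I. (x \<bullet> f i - c i)\<^sup>2)"
    unfolding s x
    by (simp add: power2_diff sum.distrib sum_subtractf sum_distrib_left mult.assoc)
  finally show ?thesis .
qed

lemma Bessel_inequality:
  assumes "finite I" "orthonormal_family I f"
  shows "(\<Sum>i\<in>I. (x \<bullet> f i)\<^sup>2) \<le> (norm x)\<^sup>2"
proof -
  have "(\<Sum>i\<in>I. (x \<bullet> f i - x \<bullet> f i)\<^sup>2) = 0" by simp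
  then show ?thesis
    using norm_diff_orthonormal_sum[OF assms, of x "\<lambda>i. x \<bullet> f i"]
      zero_le_power2[of "norm (x - (\<Sum>i\<in>I. (x \<bullet> f i) *\<^sub>R f i))"] by linarith
qed

lemma span_image_sumE:
  fixes f :: "'i \<Rightarrow> 'a::real_vector"
  assumes "finite I" "x \<in> span (f ` I)"
  obtains c where "x = (\<Sum>i\<in>I. c i *\<^sub>R f i)"
proof -
  let ?S = "{x. \<exists>c. x = (\<Sum>i\<in>I. c i *\<^sub>R f i)}"
  have sub: "subspace ?S"
  proof (rule subspaceI)
    show "0 \<in> ?S" by (auto intro!: exI[of _ "\<lambda>_. 0"])
    show "a + b \<in> ?S" if ab: "a \<in> ?S" "b \<in> ?S" for a b
    proof -
      obtain c d where "a = (\<Sum>i\<in>I. c i *\<^sub>R f i)" "b = (\<Sum>i\<in>I. d i *\<^sub>R f i)"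
        using ab by blast
      then show ?thesis
        by (auto intro!: exI[of _ "\<lambda>i. c i + d i"] simp: scaleR_add_left sum.distrib)
    qed
    show "r *\<^sub>R a \<in> ?S" if a: "a \<in> ?S" for r a
    proof -
      obtain c where "a = (\<Sum>i\<in>I. c i *\<^sub>R f i)" using a by blast
      then show ?thesis
        by (auto intro!: exI[of _ "\<lambda>i. r * c i"] simp: scaleR_sum_right)
    qed
  qed
  have "f ` I \<subseteq> ?S"
  proof
    fix y assume "y \<in> f ` I"
    then obtain j where "j \<in> I" "y = f j" by blast
    then have "y = (\<Sum>i\<in>I. (if i = j then 1 else 0) *\<^sub>R f i)"
      using assms(1) by (simp add: if_distrib[of "\<lambda>c. c *\<^sub>R _"] sum.delta cong: if_cong)
    then show "y \<in> ?S" by (intro CollectI exI)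
  qed
  then show thesis using span_minimal[OF _ sub] assms(2) that by blast
qed

lemma orthonormal_family_inj_on: "orthonormal_family I f \<Longrightarrow> inj_on f I"
  unfolding orthonormal_family_def inj_on_def by (metis zero_neq_one)

lemma orthonormal_family_independent:
  assumes "orthonormal_family I f"
  shows "independent (f ` I)"
proof (rule pairwise_orthogonal_independent)
  show "pairwise orthogonal (f ` I)"
    unfolding pairwise_def orthogonal_def using orthonormal_familyD[OF assms] by force
  show "0 \<notin> f ` I"
    using orthonormal_familyD[OF assms] by (metis imageE inner_zero_left zero_neq_one)
qed

lemma orthonormal_family_dim_span:
  fixes f :: "'i \<Rightarrow> 'a::euclidean_space"
  assumes "orthonormal_family I f"
  shows "dim (span (f ` I)) = card I"
  using dim_eq_card_independent[OF orthonormal_family_independent[OF assms]]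
    card_image[OF orthonormal_family_inj_on[OF assms]] by simp

lemma orthonormal_family_spans:
  fixes f :: "'i \<Rightarrow> 'a::euclidean_space"
  assumes "finite I" "orthonormal_family I f" "f ` I \<subseteq> W" "card I = dim W"
  shows "W \<subseteq> span (f ` I)"
  using card_eq_dim[OF assms(3)] assms(1,4) card_image[OF orthonormal_family_inj_on[OF assms(2)]]
    orthonormal_family_independent[OF assms(2)] by simp

lemma orthonormal_expansion:
  fixes f :: "'i \<Rightarrow> 'a::euclidean_space"
  assumes "finite I" "orthonormal_family I f" "f ` I \<subseteq> W" "card I = dim W" "x \<in> W"
  shows "x = (\<Sum>i\<in>I. (x \<bullet> f i) *\<^sub>R f i)"
proof -
  obtain c where c: "x = (\<Sum>i\<in>I. c i *\<^sub>R f i)"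
    using span_image_sumE[OF assms(1)] orthonormal_family_spans[OF assms(1-4)] assms(5) by blast
  have "x \<bullet> f i = c i" if "i \<in> I" for i
    unfolding c using orthonormal_family_inner_sum[OF assms(1,2) that] .
  then show ?thesis using c by simp
qed

lemma Parseval:
  fixes f :: "'i \<Rightarrow> 'a::euclidean_space"
  assumes "finite I" "orthonormal_family I f" "card I = DIM('a)"
  shows "(\<Sum>i\<in>I. (x \<bullet> f i) * (y \<bullet> f i)) = x \<bullet> y"
proof -
  have "x = (\<Sum>i\<in>I. (x \<bullet> f i) *\<^sub>R f i)"
    using orthonormal_expansion[OF assms(1,2), of UNIV] assms(3) by simp
  then have "x \<bullet> y = (\<Sum>i\<in>I. (x \<bullet> f i) *\<^sub>R f i) \<bullet> y" by simp
  also have "\<dots> = (\<Sum>i\<in>I. (x \<bullet> f i) * (y \<bullet> f i))"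
    unfolding inner_sum_left by (simp add: inner_commute[of y])
  finally show ?thesis by simp
qed

section \<open>The spectral theorem\<close>

lemma inner_symmetric_matrix:
  fixes A :: "real^'n^'n"
  assumes "transpose A = A"
  shows "x \<bullet> (A *v y) = (A *v x) \<bullet> y"
  using dot_lmul_matrix[of x A y] transpose_matrix_vector[of A x] assms by simp

text \<open>A maximiser of the Rayleigh quotient on the unit sphere of the subspace is an eigenvector. The
  invariance of the subspace is what puts the residual \<open>A x - c x\<close> among the admissible
  directions of variation.\<close>

lemma symmetric_matrix_eigenvector_in_invariant_subspace:
  fixes A :: "real^'n^'n"
  assumes sym: "transpose A = A" and S: "subspace S" and inv: "\<And>x. x \<in> S \<Longrightarrow> A *v x \<in> S"
    and nz: "y \<in> S" "y \<noteq> 0"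
  obtains x c where "x \<in> S" "norm x = 1" "A *v x = c *\<^sub>R x"
proof -
  let ?q = "\<lambda>x. x \<bullet> (A *v x)"
  let ?U = "S \<inter> sphere 0 1"
  have "compact ?U"
    using closed_subspace[OF S] compact_sphere by (metis closed_Int_compact)
  moreover have "y /\<^sub>R norm y \<in> ?U" using nz S by (simp add: subspace_scale)
  moreover have "continuous_on ?U ?q"
    by (intro continuous_intros linear_continuous_on) (simp add: linear_linear)
  ultimately obtain x where x: "x \<in> ?U" and max: "\<And>z. z \<in> ?U \<Longrightarrow> ?q z \<le> ?q x"
    using continuous_attains_sup[of ?U ?q] by blast
  define c where "c = ?q x"
  define r where "r = A *v x - c *\<^sub>R x"
  have max': "?q z \<le> c * (norm z)\<^sup>2" if "z \<in> S" for z
  proof (cases "z = 0")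
    case False
    have "?q (z /\<^sub>R norm z) \<le> c"
      unfolding c_def using False that S by (intro max) (simp add: subspace_scale)
    then show ?thesis using False
      by (simp add: matrix_vector_mult_scaleR divide_simps power2_eq_square)
  qed simp
  have nx: "x \<bullet> x = 1" using x by (simp add: norm_eq_1)
  have r: "r \<in> S" unfolding r_def using x S inv by (simp add: subspace_diff subspace_scale)
  define d where "d = c * (r \<bullet> r) - ?q r"
  have d: "0 \<le> d" unfolding d_def using max'[OF r] by (simp add: power2_norm_eq_inner)
  have rr: "r \<bullet> (A *v x) = c * (x \<bullet> r) + r \<bullet> r"
    unfolding r_def by (simp add: inner_diff inner_commute algebra_simps)
  \<comment> \<open>First variation of the Rayleigh quotient at its maximum, in the direction of the residual.\<close>
  have var: "2 * t * (r \<bullet> r) \<le> t\<^sup>2 * d" for t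
  proof -
    have "x + t *\<^sub>R r \<in> S" using x r S by (simp add: subspace_add subspace_scale)
    from max'[OF this] have "?q (x + t *\<^sub>R r) \<le> c * ((x + t *\<^sub>R r) \<bullet> (x + t *\<^sub>R r))"
      by (simp add: power2_norm_eq_inner)
    also have "(x + t *\<^sub>R r) \<bullet> (x + t *\<^sub>R r) = 1 + 2 * t * (x \<bullet> r) + t\<^sup>2 * (r \<bullet> r)"
      using nx by (simp add: inner_add inner_commute power2_eq_square algebra_simps)
    finally have "?q (x + t *\<^sub>R r) \<le> c * (1 + 2 * t * (x \<bullet> r) + t\<^sup>2 * (r \<bullet> r))" .
    moreover have "?q (x + t *\<^sub>R r) = c + 2 * t * (r \<bullet> (A *v x)) + t\<^sup>2 * ?q r"
      using inner_symmetric_matrix[OF sym, of x r]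
      by (simp add: c_def matrix_vector_right_distrib matrix_vector_mult_scaleR inner_add
          inner_commute power2_eq_square algebra_simps)
    ultimately have "c + 2 * t * (c * (x \<bullet> r) + r \<bullet> r) + t\<^sup>2 * ?q r
        \<le> c * (1 + 2 * t * (x \<bullet> r) + t\<^sup>2 * (r \<bullet> r))"
      unfolding rr by simp
    then show ?thesis unfolding d_def by (simp add: algebra_simps)
  qed
  \<comment> \<open>The linear term beats the quadratic one for small \<open>t\<close>; \<open>t = (r \<bullet> r) / d\<close> is small enough.\<close>
  have "r \<bullet> r \<le> 0"
  proof (cases "d = 0")
    case True
    then show ?thesis using var[of 1] by simp
  next
    case False
    then have "2 * (r \<bullet> r) * (r \<bullet> r) / d \<le> (r \<bullet> r) * (r \<bullet> r) / d"
      using var[of "(r \<bullet> r) / d"] by (simp add: power2_eq_square)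
    then have "(r \<bullet> r) * (r \<bullet> r) \<le> 0" using False d by (simp add: divide_simps)
    then show ?thesis by (simp add: mult_le_0_iff)
  qed
  then have "r = 0" by (metis inner_ge_zero antisym inner_eq_zero_iff)
  then have "A *v x = c *\<^sub>R x" unfolding r_def by simp
  moreover have "x \<in> S" "norm x = 1" using x by simp_all
  ultimately show thesis using that by blast
qed

text \<open>Induction on the number of eigenvectors: the orthogonal complement of those already found is
  invariant by symmetry, and it is nonzero as long as there are fewer than \<open>CARD('n)\<close> of them.\<close>

lemma symmetric_matrix_orthonormal_eigenvectors:
  fixes A :: "real^'n^'n"
  assumes sym: "transpose A = A" and "k \<le> CARD('n)"
  shows "\<exists>e d. orthonormal_family {1..k} e \<and> (\<forall>i\<in>{1..k}. A *v e i = d i *\<^sub>R e i)"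
  using assms(2)
proof (induction k)
  case 0
  then show ?case by (simp add: orthonormal_family_def)
next
  case (Suc k)
  then obtain e d where e: "orthonormal_family {1..k} e"
    and ed: "\<forall>i\<in>{1..k}. A *v e i = d i *\<^sub>R e i" by auto
  define S where "S = {y. \<forall>z\<in>span (e ` {1..k}). orthogonal z y}"
  have S: "subspace S"
    unfolding S_def orthogonal_def by (simp add: subspace_def inner_add_right)
  have Se: "y \<in> S \<longleftrightarrow> (\<forall>i\<in>{1..k}. e i \<bullet> y = 0)" for y
  proof
    show "\<forall>i\<in>{1..k}. e i \<bullet> y = 0" if "y \<in> S"
      using that unfolding S_def orthogonal_def by (auto simp: span_base)
    show "y \<in> S" if *: "\<forall>i\<in>{1..k}. e i \<bullet> y = 0"
    proof -
      have "orthogonal y z" if "z \<in> span (e ` {1..k})" for z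
        by (rule orthogonal_to_span[OF that]) (use * in \<open>auto simp: orthogonal_def inner_commute\<close>)
      then show ?thesis unfolding S_def by (simp add: orthogonal_commute)
    qed
  qed
  have "dim S + dim (span (e ` {1..k})) = CARD('n)"
    using dim_subspace_orthogonal_to_vectors[OF subspace_span subspace_UNIV, of "e ` {1..k}"]
    unfolding S_def by simp
  then have "dim S \<noteq> 0" using orthonormal_family_dim_span[OF e] Suc.prems by (simp del: dim_eq_0)
  then obtain y where y: "y \<in> S" "y \<noteq> 0" by auto
  have inv: "A *v z \<in> S" if "z \<in> S" for z
    using that ed unfolding Se by (simp add: inner_symmetric_matrix[OF sym])
  obtain x c where x: "x \<in> S" "norm x = 1" "A *v x = c *\<^sub>R x"
    using symmetric_matrix_eigenvector_in_invariant_subspace[OF sym S inv y] .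
  have *: "{1..Suc k} = insert (Suc k) {1..k}" by auto
  have "orthonormal_family {1..Suc k} (e(Suc k := x))"
    using e x Se[of x] unfolding orthonormal_family_def *
    by (auto simp: inner_commute norm_eq_1)
  moreover have "\<forall>i\<in>{1..Suc k}. A *v (e(Suc k := x)) i = (d(Suc k := c)) i *\<^sub>R (e(Suc k := x)) i"
    using ed x unfolding * by auto
  ultimately show ?case by blast
qed

text \<open>Conjugating by the orthogonal matrix whose columns are the eigenvectors turns
  \<open>t - A\<close> into a diagonal matrix.\<close>

lemma charpoly_orthonormal_eigenvectors:
  fixes A :: "real^'n^'n"
  assumes e: "orthonormal_family {1..CARD('n)} e"
    and ed: "\<And>i. i \<in> {1..CARD('n)} \<Longrightarrow> A *v e i = d i *\<^sub>R e i"
  shows "det (mat t - A) = (\<Prod>i = 1..CARD('n). t - d i)"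
proof -
  obtain h where h: "bij_betw h (UNIV :: 'n set) {1..CARD('n)}"
    using bij_betw_iff_card[of "UNIV :: 'n set" "{1..CARD('n)}"] by auto
  have hin: "h j \<in> {1..CARD('n)}" for j using h by (auto simp: bij_betw_def)
  have hinj: "h i = h j \<longleftrightarrow> i = j" for i j using h by (auto simp: bij_betw_def inj_eq)
  define Q :: "real^'n^'n" where "Q = (\<chi> i j. e (h j) $ i)"
  have QQ: "transpose Q ** Q = mat 1"
    unfolding vec_eq_iff
    using orthonormal_familyD[OF e hin hin]
    by (auto simp: Q_def transpose_def matrix_matrix_mult_def mat_def inner_vec_def hinj)
  have diag: "(transpose Q ** (mat t - A) ** Q) $ i $ j = (if i = j then t - d (h j) else 0)"
    for i j
  proof -
    have "column j ((mat t - A) ** Q) = (mat t - A) *v e (h j)"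
      by (simp add: vec_eq_iff column_def matrix_matrix_mult_def matrix_vector_mult_def Q_def)
    also have "\<dots> = (t - d (h j)) *\<^sub>R e (h j)"
    proof -
      have "mat t *v x = t *\<^sub>R x" for x :: "real^'n"
        by (simp add: vec_eq_iff matrix_vector_mult_def mat_def if_distrib[of "\<lambda>c. c * _"]
            sum.delta cong: if_cong)
      then show ?thesis
        by (simp add: matrix_vector_mult_diff_rdistrib ed[OF hin] scaleR_diff_left)
    qed
    finally have col: "column j ((mat t - A) ** Q) = (t - d (h j)) *\<^sub>R e (h j)" .
    have "(transpose Q ** ((mat t - A) ** Q)) $ i $ j = e (h i) \<bullet> column j ((mat t - A) ** Q)"
      unfolding matrix_matrix_mult_def[of "transpose Q"]
      by (simp add: transpose_def column_def inner_vec_def) (simp add: Q_def)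
    then show ?thesis
      using orthonormal_familyD[OF e hin hin, of i j]
      by (simp add: matrix_mul_assoc col hinj)
  qed
  have "det (transpose Q) * det Q = 1" using QQ by (metis det_I det_mul)
  then have "det (mat t - A) = det (transpose Q ** (mat t - A) ** Q)"
    by (simp add: det_mul mult.commute mult.left_commute)
  also have "\<dots> = (\<Prod>j\<in>UNIV. t - d (h j))"
    using det_diagonal[of "transpose Q ** (mat t - A) ** Q"] diag by simp
  also have "\<dots> = (\<Prod>i = 1..CARD('n). t - d i)"
    using prod.reindex_bij_betw[OF h, of "\<lambda>i. t - d i"] by simp
  finally show ?thesis .
qed

lemma proots_prod_linear_factors:
  fixes a :: "'i \<Rightarrow> 'a::field"
  assumes "finite I"
  shows "proots (\<Prod>i\<in>I. [:- a i, 1:]) = image_mset a (mset_set I)"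
proof -
  have "proots (\<Prod>i\<in>I. [:- a i, 1:]) = (\<Sum>i\<in>I. {#a i#})"
    by (subst proots_prod) auto
  then show ?thesis using assms by (simp add: sum_unfold_sum_mset)
qed

text \<open>Equal products of linear factors, read as polynomials, have the same multiset of roots. This is
  what identifies the eigenvalues found variationally with the given enumeration of the roots of
  the characteristic polynomial, multiplicities included.\<close>

lemma prod_linear_factors_unique:
  fixes a b :: "'i \<Rightarrow> real"
  assumes "finite I" "\<And>t. (\<Prod>i\<in>I. t - a i) = (\<Prod>i\<in>I. t - b i)"
  obtains p where "p permutes I" "\<And>i. i \<in> I \<Longrightarrow> a i = b (p i)"
proof -
  have "(\<Prod>i\<in>I. [:- a i, 1:]) = (\<Prod>i\<in>I. [:- b i, 1:])"
    unfolding poly_eq_poly_eq_iff[symmetric] fun_eq_iff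
    using assms(2) by (simp add: poly_prod)
  then have "image_mset a (mset_set I) = image_mset b (mset_set I)"
    using proots_prod_linear_factors[OF assms(1)] by metis
  then show thesis using image_mset_eq_implies_permutes[OF assms(1)] that by metis
qed

theorem spectral_theorem_ordered_eigenvalues:
  fixes A :: "real^'n^'n"
  assumes sym: "transpose A = A" and ev: "ordered_eigenvalues A lam"
  obtains e where "orthonormal_family {1..CARD('n)} e"
    "\<And>i. i \<in> {1..CARD('n)} \<Longrightarrow> A *v e i = lam i *\<^sub>R e i"
proof -
  let ?I = "{1..CARD('n)}"
  obtain f d where f: "orthonormal_family ?I f" and fd: "\<forall>i\<in>?I. A *v f i = d i *\<^sub>R f i"
    using symmetric_matrix_orthonormal_eigenvectors[OF sym, of "CARD('n)"] by auto
  have "(\<Prod>i\<in>?I. t - lam i) = (\<Prod>i\<in>?I. t - d i)" for t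
    using charpoly_orthonormal_eigenvectors[OF f, of A d t] fd ev
    unfolding ordered_eigenvalues_def by auto
  then obtain p where p: "p permutes ?I" "\<And>i. i \<in> ?I \<Longrightarrow> lam i = d (p i)"
    using prod_linear_factors_unique[of ?I lam d] by blast
  have pin: "p i \<in> ?I" if "i \<in> ?I" for i using p(1) that by (simp only: permutes_in_image)
  have pinj: "p i = p j \<longleftrightarrow> i = j" for i j using permutes_inj[OF p(1)] by (simp add: inj_eq)
  have "orthonormal_family ?I (\<lambda>i. f (p i))"
    unfolding orthonormal_family_def using orthonormal_familyD[OF f pin pin] pinj by simp
  moreover have "A *v f (p i) = lam i *\<^sub>R f (p i)" if "i \<in> ?I" for i
    using fd pin[OF that] p(2)[OF that] by simp
  ultimately show thesis using that by blast
qed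

section \<open>Angles between subspaces\<close>

text \<open>Here \<open>p l\<close> is the orthogonal projection of the basis vector \<open>f l\<close> onto the span of the \<open>y i\<close>.
  The sum of the \<open>(norm (p l))\<^sup>2 = f l \<bullet> p l\<close> is the trace of the projector, hence the dimension of
  its range. A biorthogonal family \<open>b\<close> gives the coordinates in the span of \<open>y\<close> directly, so the
  trace can be evaluated without orthonormalising \<open>y\<close>.\<close>

lemma biorthogonal_projection_trace:
  fixes f p :: "'j \<Rightarrow> 'a::euclidean_space" and y b :: "'i \<Rightarrow> 'a"
  assumes J: "finite J" "orthonormal_family J f" "card J = DIM('a)"
    and I: "finite I" "\<forall>i\<in>I. \<forall>j\<in>I. y i \<bullet> b j = (if i = j then 1 else 0)"
    and p: "\<forall>l\<in>J. p l \<in> span (y ` I)" "\<forall>l\<in>J. \<forall>s\<in>span (y ` I). (f l - p l) \<bullet> s = 0"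
  shows "(\<Sum>l\<in>J. (norm (p l))\<^sup>2) = card I"
    and "l \<in> J \<Longrightarrow> p l = (\<Sum>i\<in>I. (p l \<bullet> b i) *\<^sub>R y i)"
    and "l \<in> J \<Longrightarrow> (norm (p l))\<^sup>2 = f l \<bullet> p l"
proof -
  have p1: "p l \<in> span (y ` I)" if "l \<in> J" for l using p(1) that by blast
  have p2: "(f l - p l) \<bullet> s = 0" if "l \<in> J" "s \<in> span (y ` I)" for l s using p(2) that by blast
  have exp: "s = (\<Sum>i\<in>I. (s \<bullet> b i) *\<^sub>R y i)" if s: "s \<in> span (y ` I)" for s
  proof -
    obtain c where c: "s = (\<Sum>i\<in>I. c i *\<^sub>R y i)"
      using span_image_sumE[OF I(1) s] .
    have "s \<bullet> b j = c j" if "j \<in> I" for j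
    proof -
      have "s \<bullet> b j = (\<Sum>i\<in>I. if i = j then c i else 0)"
        unfolding c inner_sum_left by (rule sum.cong) (use I(2) that in auto)
      then show ?thesis using I(1) that by simp
    qed
    then show ?thesis using c by simp
  qed
  show "p l = (\<Sum>i\<in>I. (p l \<bullet> b i) *\<^sub>R y i)" if "l \<in> J" for l
    using exp[OF p1[OF that]] .
  show n: "(norm (p l))\<^sup>2 = f l \<bullet> p l" if "l \<in> J" for l
    using p2[OF that p1[OF that]] by (simp add: power2_norm_eq_inner inner_diff_left)
  \<comment> \<open>The projections \<open>q i\<close> of the \<open>b i\<close>: moving the projector from \<open>f l\<close> to \<open>b i\<close> makes the sum over
    the basis \<open>f\<close> an instance of Parseval's identity.\<close>
  have "\<forall>i. \<exists>q. q \<in> span (y ` I) \<and> (\<forall>s\<in>span (y ` I). (b i - q) \<bullet> s = 0)"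
  proof
    fix i
    obtain q z where "q \<in> span (y ` I)" "\<And>s. s \<in> span (y ` I) \<Longrightarrow> orthogonal z s" "b i = q + z"
      using orthogonal_subspace_decomp_exists[of "y ` I" "b i"] by metis
    then show "\<exists>q. q \<in> span (y ` I) \<and> (\<forall>s\<in>span (y ` I). (b i - q) \<bullet> s = 0)"
      by (intro exI[of _ q]) (simp add: orthogonal_def)
  qed
  then obtain q where q: "\<And>i. q i \<in> span (y ` I)"
      "\<And>i s. s \<in> span (y ` I) \<Longrightarrow> (b i - q i) \<bullet> s = 0" by metis
  have pb: "p l \<bullet> b i = f l \<bullet> q i" if "l \<in> J" for l i
    using q(2)[OF p1[OF that], of i] p2[OF that q(1), of i]
    by (simp add: inner_diff inner_commute)
  have "(\<Sum>l\<in>J. (norm (p l))\<^sup>2) = (\<Sum>l\<in>J. \<Sum>i\<in>I. (q i \<bullet> f l) * (y i \<bullet> f l))"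
  proof (rule sum.cong[OF refl])
    fix l assume l: "l \<in> J"
    have "f l \<bullet> p l = f l \<bullet> (\<Sum>i\<in>I. (p l \<bullet> b i) *\<^sub>R y i)" using exp[OF p1[OF l]] by simp
    also have "\<dots> = (\<Sum>i\<in>I. (q i \<bullet> f l) * (y i \<bullet> f l))"
      unfolding inner_sum_right by (simp add: pb[OF l] inner_commute[of "f l"])
    finally show "(norm (p l))\<^sup>2 = (\<Sum>i\<in>I. (q i \<bullet> f l) * (y i \<bullet> f l))"
      by (simp add: n[OF l])
  qed
  also have "\<dots> = (\<Sum>i\<in>I. q i \<bullet> y i)"
    by (subst sum.swap) (simp add: Parseval[OF J])
  also have "\<dots> = (\<Sum>i\<in>I. 1)"
  proof (rule sum.cong[OF refl])
    fix i assume i: "i \<in> I"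
    have "(b i - q i) \<bullet> y i = 0" using q(2)[of "y i" i] i by (simp add: span_base)
    moreover have "y i \<bullet> b i = 1" using I(2) i by simp
    ultimately show "q i \<bullet> y i = 1" unfolding inner_diff_left inner_commute[of "y i"] by simp
  qed
  finally show "(\<Sum>l\<in>J. (norm (p l))\<^sup>2) = card I" by simp
qed

text \<open>The left-hand side is the sum of the squared sines of the angles between the span of the \<open>f l\<close>,
  \<open>l \<in> H\<close>, and the span of the \<open>y i\<close>, two spaces of the same dimension. This quantity is symmetric
  in the two spaces: by the trace identity it equals the sum of \<open>(norm (p l))\<^sup>2\<close> over the
  complementary indices. Each of these is at most the sum of the \<open>(y i \<bullet> f l)\<^sup>2\<close>, although the
  \<open>y i\<close> need not be orthonormal: having the orthonormal family \<open>b\<close> as a biorthogonal partner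
  makes their Gram matrix at least the identity.\<close>

lemma sum_norm_diff_projection_le:
  fixes f p :: "'j \<Rightarrow> 'a::euclidean_space" and y b :: "'i \<Rightarrow> 'a"
  assumes J: "finite J" "orthonormal_family J f" "card J = DIM('a)"
    and I: "finite I" "\<forall>i\<in>I. \<forall>j\<in>I. y i \<bullet> b j = (if i = j then 1 else 0)"
    and b: "orthonormal_family I b"
    and p: "\<forall>l\<in>J. p l \<in> span (y ` I)" "\<forall>l\<in>J. \<forall>s\<in>span (y ` I). (f l - p l) \<bullet> s = 0"
    and H: "H \<subseteq> J" "card H = card I"
  shows "(\<Sum>l\<in>H. (norm (f l - p l))\<^sup>2) \<le> (\<Sum>l\<in>J-H. \<Sum>i\<in>I. (y i \<bullet> f l)\<^sup>2)"
proof -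
  note tr = biorthogonal_projection_trace[OF J I p]
  have "(\<Sum>l\<in>H. (norm (f l - p l))\<^sup>2) = (\<Sum>l\<in>H. 1 - (norm (p l))\<^sup>2)"
  proof (rule sum.cong[OF refl])
    fix l assume "l \<in> H"
    then have l: "l \<in> J" using H by blast
    have "(norm (f l - p l))\<^sup>2 = f l \<bullet> f l - 2 * (f l \<bullet> p l) + (norm (p l))\<^sup>2"
      by (simp add: power2_norm_eq_inner inner_diff inner_commute)
    then show "(norm (f l - p l))\<^sup>2 = 1 - (norm (p l))\<^sup>2"
      using tr(3)[OF l] orthonormal_familyD[OF J(2) l l] by simp
  qed
  also have "\<dots> = (\<Sum>l\<in>J-H. (norm (p l))\<^sup>2)"
    using tr(1) H(2) sum.subset_diff[OF H(1) J(1), of "\<lambda>l. (norm (p l))\<^sup>2"]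
    by (simp add: sum_subtractf)
  also have "\<dots> \<le> (\<Sum>l\<in>J-H. \<Sum>i\<in>I. (y i \<bullet> f l)\<^sup>2)"
  proof (rule sum_mono)
    fix l assume "l \<in> J - H"
    then have l: "l \<in> J" by blast
    have "f l \<bullet> p l = (\<Sum>i\<in>I. (p l \<bullet> b i) * (y i \<bullet> f l))"
      using arg_cong[OF tr(2)[OF l], of "\<lambda>z. f l \<bullet> z"]
      by (simp add: inner_sum_right inner_commute)
    then have "((norm (p l))\<^sup>2)\<^sup>2 = (\<Sum>i\<in>I. (p l \<bullet> b i) * (y i \<bullet> f l))\<^sup>2"
      using tr(3)[OF l] by simp
    also have "\<dots> \<le> (\<Sum>i\<in>I. (p l \<bullet> b i)\<^sup>2) * (\<Sum>i\<in>I. (y i \<bullet> f l)\<^sup>2)"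
      by (rule Cauchy_Schwarz_ineq_sum)
    also have "\<dots> \<le> (norm (p l))\<^sup>2 * (\<Sum>i\<in>I. (y i \<bullet> f l)\<^sup>2)"
      by (intro mult_right_mono Bessel_inequality[OF I(1) b] sum_nonneg) simp
    finally show "(norm (p l))\<^sup>2 \<le> (\<Sum>i\<in>I. (y i \<bullet> f l)\<^sup>2)"
      by (cases "p l = 0") (simp_all add: power2_eq_square sum_nonneg)
  qed
  finally show ?thesis .
qed

text \<open>The same symmetry of the angles, for two orthonormal families.\<close>

lemma sum_complement_orthonormal:
  fixes f :: "'j \<Rightarrow> 'a::euclidean_space" and g :: "'i \<Rightarrow> 'a"
  assumes J: "finite J" "orthonormal_family J f" "card J = DIM('a)"
    and g: "orthonormal_family I g"
    and H: "H \<subseteq> J" "card H = card I"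
  shows "(\<Sum>l\<in>J-H. \<Sum>i\<in>I. (g i \<bullet> f l)\<^sup>2) = (\<Sum>l\<in>H. 1 - (\<Sum>i\<in>I. (g i \<bullet> f l)\<^sup>2))"
proof -
  have "(\<Sum>l\<in>J. \<Sum>i\<in>I. (g i \<bullet> f l)\<^sup>2) = (\<Sum>i\<in>I. 1)"
    unfolding sum.swap[of _ I J]
    by (rule sum.cong[OF refl])
      (use Parseval[OF J] orthonormal_familyD[OF g] in \<open>simp add: power2_eq_square\<close>)
  then show ?thesis
    using H(2) sum.subset_diff[OF H(1) J(1), of "\<lambda>l. \<Sum>i\<in>I. (g i \<bullet> f l)\<^sup>2"]
    by (simp add: sum_subtractf)
qed

section \<open>The energy inner product\<close>

locale spd_eigenbasis =
  fixes A :: "real^'n^'n" and lam :: "nat \<Rightarrow> real" and e :: "nat \<Rightarrow> real^'n"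
  assumes spd: "spd A"
    and orthonormal: "orthonormal_family {1..CARD('n)} e"
    and eigen: "\<And>i. i \<in> {1..CARD('n)} \<Longrightarrow> A *v e i = lam i *\<^sub>R e i"
begin

lemma symmetric_A: "transpose A = A" using spd by (simp add: spd_def)

lemma ip_A_pos: "x \<noteq> 0 \<Longrightarrow> 0 < ip_A A x x" using spd by (simp add: spd_def ip_A_def)

lemma basis_card: "finite {1..CARD('n)}" "card {1..CARD('n)} = DIM(real^'n)" by simp_all

lemma lam_pos: "i \<in> {1..CARD('n)} \<Longrightarrow> 0 < lam i"
proof -
  assume i: "i \<in> {1..CARD('n)}"
  have ii: "e i \<bullet> e i = 1" using orthonormal_familyD[OF orthonormal i i] by simp
  then have "e i \<noteq> 0" by auto
  from ip_A_pos[OF this] show ?thesis by (simp add: ip_A_def eigen[OF i] ii)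
qed

text \<open>This is the square root \<open>A\<^sup>1\<^sup>/\<^sup>2\<close>. It maps the energy inner product isometrically to the Euclidean
  one, so that Euclidean facts about orthonormal families and projections apply to the energy norm.\<close>

definition energy_root :: "real^'n \<Rightarrow> real^'n" where
  "energy_root x = (\<Sum>i = 1..CARD('n). (sqrt (lam i) * (x \<bullet> e i)) *\<^sub>R e i)"

lemma linear_energy_root: "linear energy_root"
  unfolding energy_root_def
  by (intro linear_compose_sum ballI linearI)
     (simp_all add: inner_add_left distrib_left scaleR_add_left mult.left_commute)

lemma energy_root_inner_basis:
  "i \<in> {1..CARD('n)} \<Longrightarrow> energy_root x \<bullet> e i = sqrt (lam i) * (x \<bullet> e i)"
  unfolding energy_root_def
  by (rule orthonormal_family_inner_sum[OF basis_card(1) orthonormal])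

lemma ip_A_eq_sum: "ip_A A x y = (\<Sum>i = 1..CARD('n). lam i * ((x \<bullet> e i) * (y \<bullet> e i)))"
proof -
  have "(A *v y) \<bullet> e i = lam i * (y \<bullet> e i)" if "i \<in> {1..CARD('n)}" for i
    using inner_symmetric_matrix[OF symmetric_A, of y "e i"] eigen[OF that] by simp
  then show ?thesis
    using Parseval[OF basis_card(1) orthonormal basis_card(2), of x "A *v y"]
    by (simp add: ip_A_def mult.left_commute)
qed

lemma energy_root_inner: "energy_root x \<bullet> energy_root y = ip_A A x y"
proof -
  have "energy_root x \<bullet> energy_root y
      = (\<Sum>i = 1..CARD('n). (energy_root x \<bullet> e i) * (energy_root y \<bullet> e i))"
    using Parseval[OF basis_card(1) orthonormal basis_card(2)] by simp
  also have "\<dots> = ip_A A x y"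
    unfolding ip_A_eq_sum
  proof (rule sum.cong[OF refl])
    fix i assume i: "i \<in> {1..CARD('n)}"
    have "sqrt (lam i) * sqrt (lam i) = lam i" using lam_pos[OF i] by simp
    then show "(energy_root x \<bullet> e i) * (energy_root y \<bullet> e i)
        = lam i * ((x \<bullet> e i) * (y \<bullet> e i))"
      by (simp add: energy_root_inner_basis[OF i] algebra_simps)
  qed
  finally show ?thesis .
qed

lemma norm_energy_root: "norm (energy_root x) = norm_A A x"
  by (simp add: norm_A_def norm_eq_sqrt_inner energy_root_inner)

lemma energy_root_eq_0: "energy_root x = 0 \<longleftrightarrow> x = 0"
  using ip_A_pos[of x] energy_root_inner[of x x] linear_0[OF linear_energy_root] by force

lemma inj_energy_root: "inj energy_root"
  using linear_injective_0[OF linear_energy_root] energy_root_eq_0 by blast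

text \<open>The eigenvectors normalised in the energy norm; \<open>A\<^sup>1\<^sup>/\<^sup>2\<close> takes them back to the Euclidean
  orthonormal ones.\<close>

definition energy_eigenvector :: "nat \<Rightarrow> real^'n" where
  "energy_eigenvector i = e i /\<^sub>R sqrt (lam i)"

lemma energy_eigenvector_eigen:
  "i \<in> {1..CARD('n)} \<Longrightarrow> A *v energy_eigenvector i = lam i *\<^sub>R energy_eigenvector i"
  by (simp add: energy_eigenvector_def matrix_vector_mult_scaleR eigen)

lemma energy_root_energy_eigenvector:
  assumes i: "i \<in> {1..CARD('n)}"
  shows "energy_root (energy_eigenvector i) = e i"
proof -
  have "energy_root (e i) = (\<Sum>j = 1..CARD('n). if j = i then sqrt (lam i) *\<^sub>R e i else 0)"
    unfolding energy_root_def
    by (rule sum.cong[OF refl]) (use orthonormal_familyD[OF orthonormal i] in auto)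
  then have "energy_root (e i) = sqrt (lam i) *\<^sub>R e i" using i by simp
  then show ?thesis
    using lam_pos[OF i] by (simp add: energy_eigenvector_def linear_scale[OF linear_energy_root])
qed

lemma energy_eigenvector_orthonormal:
  "i \<in> {1..CARD('n)} \<Longrightarrow> j \<in> {1..CARD('n)} \<Longrightarrow>
    ip_A A (energy_eigenvector i) (energy_eigenvector j) = (if i = j then 1 else 0)"
  using orthonormal_familyD[OF orthonormal, of i j]
  by (simp add: energy_root_energy_eigenvector flip: energy_root_inner)

lemma proj_A_ex1:
  assumes S: "subspace S"
  shows "\<exists>!p. p \<in> S \<and> (\<forall>y\<in>S. ip_A A p y = ip_A A x y)"
proof (rule ex_ex1I)
  have sp: "span (energy_root ` S) = energy_root ` S"
    using linear_subspace_image[OF linear_energy_root S] by (simp add: span_eq_iff)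
  obtain q z where q: "q \<in> energy_root ` S" and z: "\<And>y. y \<in> energy_root ` S \<Longrightarrow> orthogonal z y"
    and qz: "energy_root x = q + z"
    using orthogonal_subspace_decomp_exists[of "energy_root ` S" "energy_root x"]
    unfolding sp by metis
  obtain p where p: "p \<in> S" "q = energy_root p" using q by blast
  have "ip_A A p y = ip_A A x y" if "y \<in> S" for y
    using z[of "energy_root y"] that qz p(2)
    by (simp add: energy_root_inner[symmetric] inner_add_left orthogonal_def)
  then show "\<exists>p. p \<in> S \<and> (\<forall>y\<in>S. ip_A A p y = ip_A A x y)" using p by blast
next
  fix p q
  assume p: "p \<in> S \<and> (\<forall>y\<in>S. ip_A A p y = ip_A A x y)"
    and q: "q \<in> S \<and> (\<forall>y\<in>S. ip_A A q y = ip_A A x y)"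
  then have "p - q \<in> S" using S by (simp add: subspace_diff)
  then have "ip_A A (p - q) (p - q) = 0"
    using p q by (simp add: ip_A_def inner_diff_left)
  then show "p = q" using ip_A_pos[of "p - q"] by force
qed

lemma proj_A_in: "subspace S \<Longrightarrow> proj_A A S x \<in> S"
  and proj_A_orthogonal: "subspace S \<Longrightarrow> y \<in> S \<Longrightarrow> ip_A A (proj_A A S x) y = ip_A A x y"
  unfolding proj_A_def using theI'[OF proj_A_ex1[of S x]] by blast+

lemma proj_A_eqI:
  assumes "subspace S" "p \<in> S" "\<And>y. y \<in> S \<Longrightarrow> ip_A A p y = ip_A A x y"
  shows "proj_A A S x = p"
  unfolding proj_A_def using the1_equality[OF proj_A_ex1[OF assms(1)]] assms(2,3) by blast

lemma proj_A_best_approximation: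
  assumes S: "subspace S" and y: "y \<in> S"
  shows "norm_A A (x - proj_A A S x) \<le> norm_A A (x - y)"
proof -
  let ?p = "proj_A A S x"
  have d: "?p - y \<in> S" using S y by (simp add: subspace_diff proj_A_in)
  have o: "orthogonal (energy_root (x - ?p)) (energy_root (?p - y))"
    unfolding orthogonal_def energy_root_inner
    using proj_A_orthogonal[OF S d, of x] by (simp add: ip_A_def inner_diff_left)
  have "energy_root (x - y) = energy_root (x - ?p) + energy_root (?p - y)"
    by (simp flip: linear_add[OF linear_energy_root])
  then have "(norm (energy_root (x - y)))\<^sup>2
      = (norm (energy_root (x - ?p)))\<^sup>2 + (norm (energy_root (?p - y)))\<^sup>2"
    using norm_add_Pythagorean[OF o] by simp
  then have "(norm (energy_root (x - ?p)))\<^sup>2 \<le> (norm (energy_root (x - y)))\<^sup>2" by simp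
  then show ?thesis
    unfolding norm_energy_root[symmetric] by (rule power2_le_imp_le) simp
qed

lemma matrix_inv_cancel: "A *v (matrix_inv A *v g) = g"
proof -
  have "inj ((*v) A)"
    using linear_injective_0[OF matrix_vector_mul_linear, of A] ip_A_pos
    by (metis ip_A_def inner_zero_right less_irrefl)
  then have "invertible A"
    using matrix_left_invertible_injective invertible_left_inverse by blast
  then have "A ** matrix_inv A = mat 1"
    unfolding invertible_def matrix_inv_def by (rule someI2_ex) blast
  then show ?thesis by (simp add: matrix_vector_mul_assoc)
qed

text \<open>Boundedness has to be shown because a supremum of an unbounded set of reals would be an
  unspecified number.\<close>

lemma eta_upper:
  assumes S: "subspace S" and g: "norm g = 1"
  shows "norm_A A (matrix_inv A *v g - proj_A A S (matrix_inv A *v g)) \<le> eta A S"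
  unfolding eta_def
proof (rule cSUP_upper)
  show "g \<in> {g. norm g = 1}" using g by simp
  have "bounded_linear (\<lambda>g. energy_root (matrix_inv A *v g))"
    by (intro linear_conv_bounded_linear[THEN iffD1]
        linear_compose[OF matrix_vector_mul_linear linear_energy_root, unfolded o_def])
  then obtain C where C: "\<And>g. norm (energy_root (matrix_inv A *v g)) \<le> norm g * C"
    using bounded_linear.bounded by blast
  show "bdd_above ((\<lambda>g. norm_A A (matrix_inv A *v g - proj_A A S (matrix_inv A *v g)))
      ` {g. norm g = 1})"
  proof (rule bdd_aboveI2)
    fix g :: "real^'n" assume "g \<in> {g. norm g = 1}"
    then show "norm_A A (matrix_inv A *v g - proj_A A S (matrix_inv A *v g)) \<le> C"
      using proj_A_best_approximation[OF S subspace_0[OF S], of "matrix_inv A *v g"] C[of g]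
      by (simp add: norm_energy_root)
  qed
qed

lemma eta_nonneg: "subspace S \<Longrightarrow> 0 \<le> eta A S"
proof -
  assume S: "subspace S"
  obtain g :: "real^'n" where "norm g = 1" using vector_choose_size[of 1] by auto
  from eta_upper[OF S this] show ?thesis
    by (rule order_trans[rotated]) (simp flip: norm_energy_root)
qed

text \<open>Duality argument: the Euclidean norm of the error \<open>z\<close> is \<open>z \<bullet> g\<close> for a unit vector \<open>g\<close>, hence the
  energy product of \<open>z\<close> with the solution of \<open>A t = g\<close>. As \<open>z\<close> is \<open>A\<close>-orthogonal to the subspace,
  only the part of \<open>t\<close> outside it counts, and \<open>eta\<close> measures that part.\<close>

lemma Aubin_Nitsche:
  assumes S: "subspace S"
  shows "norm (x - proj_A A S x) \<le> eta A S * norm_A A (x - proj_A A S x)"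
proof (cases "x - proj_A A S x = 0")
  case True
  then show ?thesis using eta_nonneg[OF S] by (simp add: norm_A_def ip_A_def)
next
  case False
  define z where "z = x - proj_A A S x"
  define g where "g = z /\<^sub>R norm z"
  let ?t = "matrix_inv A *v g"
  have g: "norm g = 1" using False by (simp add: g_def z_def)
  have "norm z = z \<bullet> g" unfolding g_def using False
    by (simp add: z_def power2_norm_eq_inner[symmetric] power2_eq_square)
  also have "\<dots> = ip_A A z ?t" by (simp add: ip_A_def matrix_inv_cancel)
  also have "\<dots> = ip_A A z (?t - proj_A A S ?t)"
    using proj_A_orthogonal[OF S proj_A_in[OF S], of x ?t]
    by (simp add: z_def ip_A_def matrix_vector_mult_diff_distrib inner_diff)
  also have "\<dots> \<le> norm_A A z * norm_A A (?t - proj_A A S ?t)"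
    by (simp add: norm_cauchy_schwarz flip: energy_root_inner norm_energy_root)
  also have "\<dots> \<le> norm_A A z * eta A S"
    using eta_upper[OF S g] by (rule mult_left_mono) (simp flip: norm_energy_root)
  finally show ?thesis by (simp add: z_def mult.commute)
qed

end

section \<open>Ritz pairs\<close>

locale ritz_system = spd_eigenbasis A lam e
  for A :: "real^'n^'n" and lam e +
  fixes W :: "(real^'n) set" and rlam :: "nat \<Rightarrow> real" and w :: "nat \<Rightarrow> real^'n"
  assumes subspace_W: "subspace W" and ritz: "ritz_pairs A W rlam w"
begin

abbreviation "ritz_index \<equiv> {1..dim W}"

lemma w_in: "i \<in> ritz_index \<Longrightarrow> w i \<in> W"
  and w_orthonormal: "i \<in> ritz_index \<Longrightarrow> j \<in> ritz_index \<Longrightarrow> ip_A A (w i) (w j) = (if i = j then 1 else 0)"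
  and ritz_equation: "i \<in> ritz_index \<Longrightarrow> x \<in> W \<Longrightarrow> (A *v w i) \<bullet> x = rlam i * (w i \<bullet> x)"
  and rlam_mono: "i \<in> ritz_index \<Longrightarrow> j \<in> ritz_index \<Longrightarrow> i \<le> j \<Longrightarrow> rlam i \<le> rlam j"
  using ritz unfolding ritz_pairs_def mono_on_def by blast+

lemma rlam_inner:
  assumes "i \<in> ritz_index" "j \<in> ritz_index"
  shows "rlam i * (w i \<bullet> w j) = (if i = j then 1 else 0)"
  using ritz_equation[OF assms(1) w_in[OF assms(2)]] w_orthonormal[OF assms(2,1)]
  by (auto simp: ip_A_def inner_commute)

lemma rlam_pos: "i \<in> ritz_index \<Longrightarrow> 0 < rlam i"
  using rlam_inner[of i i] inner_ge_zero[of "w i"] by (smt (verit) mult_nonpos_nonneg)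

text \<open>The Ritz vectors are orthogonal for both inner products. They are normalised in the energy norm;
  this scaling normalises them in the Euclidean norm.\<close>

definition scaled_ritz :: "nat \<Rightarrow> real^'n" where
  "scaled_ritz i = sqrt (rlam i) *\<^sub>R w i"

lemma scaled_ritz_orthonormal: "orthonormal_family ritz_index scaled_ritz"
  unfolding orthonormal_family_def
proof (intro ballI)
  fix i j assume ij: "i \<in> ritz_index" "j \<in> ritz_index"
  show "scaled_ritz i \<bullet> scaled_ritz j = (if i = j then 1 else 0)"
  proof (cases "i = j")
    case True
    have "sqrt (rlam i) * sqrt (rlam i) = rlam i" using rlam_pos[OF ij(1)] by simp
    then show ?thesis
      using rlam_inner[OF ij] True by (simp add: scaled_ritz_def flip: mult.assoc)
  next
    case False
    then have "w i \<bullet> w j = 0" using rlam_inner[OF ij] rlam_pos[OF ij(1)] by simp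
    then show ?thesis using False by (simp add: scaled_ritz_def)
  qed
qed

lemma inner_scaled_ritz_square:
  "i \<in> ritz_index \<Longrightarrow> (x \<bullet> scaled_ritz i)\<^sup>2 = rlam i * (x \<bullet> w i)\<^sup>2"
  using rlam_pos[of i] by (simp add: scaled_ritz_def power_mult_distrib)

lemma energy_root_ritz_orthonormal: "orthonormal_family ritz_index (\<lambda>i. energy_root (w i))"
  unfolding orthonormal_family_def energy_root_inner using w_orthonormal by blast

text \<open>The Ritz vectors are \<open>dim W\<close> in number, and \<open>A\<^sup>1\<^sup>/\<^sup>2\<close> takes them to an orthonormal family.\<close>

lemma W_subset_span_ritz: "W \<subseteq> span (w ` ritz_index)"
proof
  fix x assume x: "x \<in> W"
  let ?B = "energy_root"
  have "?B x = (\<Sum>i\<in>ritz_index. (?B x \<bullet> ?B (w i)) *\<^sub>R ?B (w i))"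
  proof (rule orthonormal_expansion[OF _ energy_root_ritz_orthonormal])
    show "(\<lambda>i. ?B (w i)) ` ritz_index \<subseteq> ?B ` W" using w_in by auto
    show "card ritz_index = dim (?B ` W)"
      using dim_image_eq[OF linear_energy_root inj_on_subset[OF inj_energy_root subset_UNIV]]
      by simp
  qed (use x in auto)
  also have "\<dots> = ?B (\<Sum>i\<in>ritz_index. (?B x \<bullet> ?B (w i)) *\<^sub>R w i)"
    by (simp add: linear_sum[OF linear_energy_root] linear_scale[OF linear_energy_root])
  finally have "x = (\<Sum>i\<in>ritz_index. (?B x \<bullet> ?B (w i)) *\<^sub>R w i)"
    using inj_energy_root by (simp add: inj_eq)
  also have "\<dots> \<in> span (w ` ritz_index)"
    by (intro span_sum span_scale span_base) blast
  finally show "x \<in> span (w ` ritz_index)" .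
qed

text \<open>The energy-orthogonal projection onto the span of the first \<open>k\<close> Ritz vectors.\<close>

definition ritz_truncation :: "nat \<Rightarrow> real^'n \<Rightarrow> real^'n" where
  "ritz_truncation k x = (\<Sum>j = 1..k. ip_A A x (w j) *\<^sub>R w j)"

lemma proj_A_eq_ritz_truncation: "proj_A A W x = ritz_truncation (dim W) x"
proof (rule proj_A_eqI[OF subspace_W])
  let ?p = "ritz_truncation (dim W) x"
  show "?p \<in> W" unfolding ritz_truncation_def
    by (intro subspace_sum subspace_scale subspace_W w_in)
  have *: "ip_A A ?p (w i) = ip_A A x (w i)" if i: "i \<in> ritz_index" for i
  proof -
    have "ip_A A ?p (w i) = (\<Sum>j\<in>ritz_index. if j = i then ip_A A x (w i) else 0)"
      unfolding ritz_truncation_def ip_A_def[of A "sum _ _"] inner_sum_left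
      by (rule sum.cong[OF refl]) (use w_orthonormal i in \<open>auto simp: ip_A_def\<close>)
    then show ?thesis using i by simp
  qed
  fix y assume "y \<in> W"
  then obtain c where "y = (\<Sum>i\<in>ritz_index. c i *\<^sub>R w i)"
    using W_subset_span_ritz span_image_sumE[of ritz_index y w] by blast
  then have "ip_A A z y = (\<Sum>i\<in>ritz_index. c i * ip_A A z (w i))" for z
    by (simp add: ip_A_def linear_sum[OF matrix_vector_mul_linear] matrix_vector_mult_scaleR
        inner_sum_right)
  then show "ip_A A ?p y = ip_A A x y" using * by simp
qed

text \<open>On the left, \<open>ip_A A v (w j) / l\<close> is \<open>v \<bullet> w j\<close> by the exact eigenvalue equation, and
  \<open>ip_A A v (w j) / rlam j\<close> is the Euclidean product of the projection of \<open>v\<close> with \<open>w j\<close> by the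
  Ritz equation. So if \<open>1 / l\<close> is separated from \<open>1 / rlam j\<close>, the component of \<open>v\<close> along \<open>w j\<close>
  is controlled by the projection error.\<close>

lemma projection_residual_inner_ritz:
  assumes v: "A *v v = l *\<^sub>R v" and l: "0 < l" and j: "j \<in> ritz_index"
  shows "(1 / l - 1 / rlam j) * ip_A A v (w j) = (v - proj_A A W v) \<bullet> w j"
proof -
  let ?p = "proj_A A W v"
  have "ip_A A v (w j) = l * (v \<bullet> w j)"
    using v inner_symmetric_matrix[OF symmetric_A, of v "w j"] by (simp add: ip_A_def)
  moreover have "ip_A A v (w j) = rlam j * (?p \<bullet> w j)"
    using proj_A_orthogonal[OF subspace_W w_in[OF j], of v]
      ritz_equation[OF j proj_A_in[OF subspace_W], of v]
    by (simp add: ip_A_def inner_commute)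
  ultimately have "v \<bullet> w j = ip_A A v (w j) / l" "?p \<bullet> w j = ip_A A v (w j) / rlam j"
    using l rlam_pos[OF j] by (simp_all add: field_simps)
  then show ?thesis by (simp add: inner_diff_left left_diff_distrib)
qed

text \<open>The truncation error is the projection error plus the components along the Ritz vectors after the
  \<open>k\<close>-th. The preceding lemma bounds each of these through the gap, and Bessel's inequality adds
  them up. The factor \<open>1 / rlam (k + 1)\<close> appears because a Ritz vector of energy norm 1 has squared
  Euclidean norm \<open>1 / rlam j\<close>; it enters once when a component is measured and once when the
  residual is tested, each time through a square root.\<close>

lemma norm_diff_ritz_truncation_le:
  assumes v: "A *v v = l *\<^sub>R v" and l: "0 < l" and k: "k < dim W" and \<delta>: "0 < \<delta>"
    and gap: "\<And>j. j \<in> {k<..dim W} \<Longrightarrow> \<delta> \<le> \<bar>1 / rlam j - 1 / l\<bar>"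
  shows "norm (v - ritz_truncation k v)
    \<le> (1 + (1 / rlam (k + 1)) / \<delta>) * norm (v - proj_A A W v)"
proof -
  let ?J = "{k<..dim W}"
  define z where "z = v - proj_A A W v"
  define q where "q = (1 / rlam (k + 1)) / \<delta>"
  have Jin: "j \<in> ritz_index" if "j \<in> ?J" for j using that by auto
  have k1: "k + 1 \<in> ritz_index" using k by auto
  have q: "0 \<le> q" using rlam_pos[OF k1] \<delta> by (simp add: q_def)
  define c where "c j = ip_A A v (w j) / sqrt (rlam j)" for j
  define s where "s = (\<Sum>j\<in>?J. c j *\<^sub>R scaled_ritz j)"
  have orth: "orthonormal_family ?J scaled_ritz"
    by (rule orthonormal_family_subset[OF scaled_ritz_orthonormal]) auto
  have "ritz_truncation (dim W) v = ritz_truncation k v + s"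
  proof -
    have "ritz_index = {1..k} \<union> ?J" using k by auto
    then have "ritz_truncation (dim W) v
        = ritz_truncation k v + (\<Sum>j\<in>?J. ip_A A v (w j) *\<^sub>R w j)"
      unfolding ritz_truncation_def by (simp add: sum.union_disjoint ivl_disj_int)
    also have "(\<Sum>j\<in>?J. ip_A A v (w j) *\<^sub>R w j) = s"
      unfolding s_def
      by (rule sum.cong[OF refl])
        (use rlam_pos[OF Jin] in \<open>force simp: c_def scaled_ritz_def\<close>)
    finally show ?thesis .
  qed
  then have dec: "v - ritz_truncation k v = z + s"
    by (simp add: z_def proj_A_eq_ritz_truncation)
  have c: "(c j)\<^sup>2 \<le> q\<^sup>2 * (z \<bullet> scaled_ritz j)\<^sup>2" if j: "j \<in> ?J" for j
  proof -
    have r: "0 < rlam j" "0 < rlam (k + 1)" "rlam (k + 1) \<le> rlam j"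
      using rlam_pos[OF Jin[OF j]] rlam_pos[OF k1] rlam_mono[OF k1 Jin[OF j]] j by auto
    have "\<delta> * \<bar>ip_A A v (w j)\<bar> \<le> \<bar>z \<bullet> w j\<bar>"
      using mult_right_mono[OF gap[OF j] abs_ge_zero[of "ip_A A v (w j)"]]
        projection_residual_inner_ritz[OF v l Jin[OF j]]
      by (simp add: z_def abs_minus_commute flip: abs_mult)
    then have "\<delta>\<^sup>2 * (ip_A A v (w j))\<^sup>2 \<le> (z \<bullet> w j)\<^sup>2"
      using power_mono[of "\<delta> * \<bar>ip_A A v (w j)\<bar>" "\<bar>z \<bullet> w j\<bar>" 2] \<delta>
      by (simp add: power_mult_distrib)
    then have "(ip_A A v (w j))\<^sup>2 \<le> (z \<bullet> w j)\<^sup>2 / \<delta>\<^sup>2"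
      using \<delta> by (simp add: field_simps)
    then have "(ip_A A v (w j))\<^sup>2 / rlam j \<le> (z \<bullet> w j)\<^sup>2 / \<delta>\<^sup>2 / rlam j"
      by (rule divide_right_mono) (use r in simp)
    then have "(c j)\<^sup>2 \<le> (z \<bullet> w j)\<^sup>2 / \<delta>\<^sup>2 / rlam j"
      using r by (simp add: c_def power_divide)
    also have "\<dots> = (z \<bullet> scaled_ritz j)\<^sup>2 / \<delta>\<^sup>2 * (1 / rlam j)\<^sup>2"
      unfolding inner_scaled_ritz_square[OF Jin[OF j]]
      using r by (simp add: power2_eq_square[of "1 / rlam j"])
    also have "\<dots> \<le> (z \<bullet> scaled_ritz j)\<^sup>2 / \<delta>\<^sup>2 * (1 / rlam (k + 1))\<^sup>2"
      using r by (intro mult_left_mono power_mono divide_left_mono) auto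
    also have "\<dots> = q\<^sup>2 * (z \<bullet> scaled_ritz j)\<^sup>2"
      by (simp add: q_def power_divide power_mult_distrib mult.commute)
    finally show ?thesis .
  qed
  have "(norm s)\<^sup>2 = (\<Sum>j\<in>?J. (c j)\<^sup>2)"
    unfolding s_def by (rule norm_orthonormal_sum[OF _ orth]) simp
  also have "\<dots> \<le> q\<^sup>2 * (\<Sum>j\<in>?J. (z \<bullet> scaled_ritz j)\<^sup>2)"
    unfolding sum_distrib_left by (rule sum_mono[OF c])
  also have "\<dots> \<le> q\<^sup>2 * (norm z)\<^sup>2"
    by (intro mult_left_mono Bessel_inequality orth) auto
  finally have "(norm s)\<^sup>2 \<le> (q * norm z)\<^sup>2" by (simp add: power_mult_distrib)
  then have "norm s \<le> q * norm z" by (rule power2_le_imp_le) (simp add: q)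
  then have "norm (v - ritz_truncation k v) \<le> norm z + q * norm z"
    unfolding dec using norm_triangle_ineq[of z s] by linarith
  then show ?thesis by (simp add: q_def z_def distrib_right)
qed

text \<open>Dimension count as in the Courant-Fischer principle: some nonzero combination of the first
  \<open>k + 1\<close> Ritz vectors is orthogonal to the first \<open>k\<close> eigenvectors. Its Rayleigh quotient is at
  most \<open>rlam (k + 1)\<close> and at least \<open>lam (k + 1)\<close>.\<close>

lemma ritz_value_ge:
  assumes mono: "mono_on {1..CARD('n)} lam" and k: "k < dim W"
  shows "lam (k + 1) \<le> rlam (k + 1)"
proof -
  let ?I = "{1..k + 1}"
  let ?E = "span (e ` {1..k})" and ?R = "span (scaled_ritz ` ?I)"
  let ?P = "{y. \<forall>x\<in>?E. orthogonal x y}"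
  have n: "dim W \<le> CARD('n)" using dim_subset_UNIV[of W] by simp
  have orth: "orthonormal_family ?I scaled_ritz"
    by (rule orthonormal_family_subset[OF scaled_ritz_orthonormal]) (use k in auto)
  have dR: "dim ?R = k + 1" using orthonormal_family_dim_span[OF orth] by simp
  have dE: "dim ?E = k"
    using orthonormal_family_dim_span[OF orthonormal_family_subset[OF orthonormal, of "{1..k}"]]
      k n by simp
  have subP: "subspace ?P"
    by (simp add: subspace_def orthogonal_def inner_add_right)
  have dP: "dim ?P + k = CARD('n)"
    using dim_subspace_orthogonal_to_vectors[OF subspace_span subspace_UNIV, of "e ` {1..k}"] dE
    by simp
  have "dim {x + y |x y. x \<in> ?R \<and> y \<in> ?P} + dim (?R \<inter> ?P) = dim ?R + dim ?P"
    by (rule dim_sums_Int[OF subspace_span subP])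
  moreover have "dim {x + y |x y. x \<in> ?R \<and> y \<in> ?P} \<le> CARD('n)"
    using dim_subset_UNIV[of "{x + y |x y. x \<in> ?R \<and> y \<in> ?P}"] by simp
  ultimately have "dim (?R \<inter> ?P) \<noteq> 0" using dR dP by linarith
  then obtain x where x: "x \<in> ?R" "x \<in> ?P" "x \<noteq> 0" by auto
  obtain c where c: "x = (\<Sum>i\<in>?I. c i *\<^sub>R scaled_ritz i)"
    using span_image_sumE[OF _ x(1)] by blast
  have Iin: "i \<in> ritz_index" if "i \<in> ?I" for i using that k by auto
  have xW: "x \<in> W"
    unfolding c scaled_ritz_def
    using Iin by (intro subspace_sum subspace_scale subspace_W w_in) auto
  have xc: "scaled_ritz i \<bullet> x = c i" if "i \<in> ?I" for i
    unfolding c using orthonormal_family_inner_sum[OF _ orth that, of c] by (simp add: inner_commute)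
  have nx: "(norm x)\<^sup>2 = (\<Sum>i\<in>?I. (c i)\<^sup>2)"
    unfolding c by (rule norm_orthonormal_sum[OF _ orth]) simp
  have "A *v x = (\<Sum>i\<in>?I. c i *\<^sub>R (A *v scaled_ritz i))"
    unfolding c by (simp only: linear_sum[OF matrix_vector_mul_linear] matrix_vector_mult_scaleR)
  then have "ip_A A x x = (\<Sum>i\<in>?I. c i * ((A *v scaled_ritz i) \<bullet> x))"
    by (simp only: ip_A_def inner_sum_right inner_scaleR_right inner_commute[of x])
  also have "\<dots> = (\<Sum>i\<in>?I. rlam i * (c i)\<^sup>2)"
  proof (rule sum.cong[OF refl])
    fix i assume i: "i \<in> ?I"
    have "(A *v scaled_ritz i) \<bullet> x = rlam i * (scaled_ritz i \<bullet> x)"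
      using ritz_equation[OF Iin[OF i] xW] by (simp add: scaled_ritz_def matrix_vector_mult_scaleR)
    then show "c i * ((A *v scaled_ritz i) \<bullet> x) = rlam i * (c i)\<^sup>2"
      using xc[OF i] by (simp add: power2_eq_square)
  qed
  also have "\<dots> \<le> rlam (k + 1) * (norm x)\<^sup>2"
    unfolding nx sum_distrib_left
    by (intro sum_mono mult_right_mono rlam_mono Iin) auto
  finally have upper: "ip_A A x x \<le> rlam (k + 1) * (norm x)\<^sup>2" .
  have "lam (k + 1) * (norm x)\<^sup>2 = (\<Sum>i = 1..CARD('n). lam (k + 1) * ((x \<bullet> e i) * (x \<bullet> e i)))"
    using Parseval[OF basis_card(1) orthonormal basis_card(2), of x x]
    by (simp add: power2_norm_eq_inner flip: sum_distrib_left)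
  also have "\<dots> \<le> ip_A A x x"
    unfolding ip_A_eq_sum
  proof (rule sum_mono)
    fix i assume i: "i \<in> {1..CARD('n)}"
    show "lam (k + 1) * ((x \<bullet> e i) * (x \<bullet> e i)) \<le> lam i * ((x \<bullet> e i) * (x \<bullet> e i))"
    proof (cases "i \<le> k")
      case True
      then have "e i \<in> ?E" using i by (intro span_base) auto
      then have "x \<bullet> e i = 0" using x(2) by (auto simp: orthogonal_def inner_commute)
      then show ?thesis by simp
    next
      case False
      then have "lam (k + 1) \<le> lam i" using mono_onD[OF mono, of "k + 1" i] i by auto
      then show ?thesis by (rule mult_right_mono) simp
    qed
  qed
  finally have "lam (k + 1) * (norm x)\<^sup>2 \<le> rlam (k + 1) * (norm x)\<^sup>2" using upper by linarith
  then show ?thesis using x(3) by simp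
qed

section \<open>The inverse power step\<close>

text \<open>The linear solve makes the outputs \<open>u' i\<close> energy-biorthogonal to the Ritz vectors, since
  \<open>A (u' i) \<bullet> w j = rlam i * (w i \<bullet> w j)\<close>. Transported by \<open>A\<^sup>1\<^sup>/\<^sup>2\<close>, the symmetry of the angles
  therefore bounds the error by the coefficients of the outputs along the unwanted eigenvectors.
  Solving with \<open>A\<close> divides the coefficient along the \<open>l\<close>-th eigenvector by \<open>lam l\<close>, which is at
  least \<open>lam (k + 1)\<close> there: this is the gain of the power step. What remains is the same sum of
  coefficients for the Ritz vectors themselves, and the symmetry of the angles in the Euclidean inner product
  converts it to the Euclidean distances of the wanted eigenvectors to the Ritz space.\<close>

lemma inverse_power_output_error:
  assumes mono: "mono_on {1..CARD('n)} lam" and k: "k < dim W"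
    and u': "\<And>i. i \<in> {1..k} \<Longrightarrow> A *v u' i = rlam i *\<^sub>R w i"
  shows "(\<Sum>i = 1..k. (norm_A A (energy_eigenvector i
            - proj_A A (span (u' ` {1..k})) (energy_eigenvector i)))\<^sup>2)
      \<le> rlam k / lam (k + 1) * (\<Sum>i = 1..k. lam i *
          (norm (energy_eigenvector i - ritz_truncation k (energy_eigenvector i)))\<^sup>2)"
proof -
  let ?J = "{1..CARD('n)}" and ?I = "{1..k}" and ?X = "span (u' ` {1..k})"
  let ?v = energy_eigenvector and ?B = energy_root
  define p where "p l = ?B (proj_A A ?X (?v l))" for l
  have n: "dim W \<le> CARD('n)" using dim_subset_UNIV[of W] by simp
  have IJ: "?I \<subseteq> ?J" using k n by auto
  have Ir: "i \<in> ritz_index" if "i \<in> ?I" for i using that k by auto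
  have BX: "span ((\<lambda>i. ?B (u' i)) ` ?I) = ?B ` ?X"
    using linear_span_image[OF linear_energy_root, of "u' ` ?I"] by (simp add: image_image)
  have bi: "?B (u' i) \<bullet> ?B (w j) = (if i = j then 1 else 0)" if "i \<in> ?I" "j \<in> ?I" for i j
    using u'[OF that(1)] rlam_inner[OF Ir[OF that(1)] Ir[OF that(2)]]
    by (simp add: energy_root_inner ip_A_def inner_symmetric_matrix[OF symmetric_A])
  have "(\<Sum>l\<in>?I. (norm (e l - p l))\<^sup>2) \<le> (\<Sum>l\<in>?J-?I. \<Sum>i\<in>?I. (?B (u' i) \<bullet> e l)\<^sup>2)"
  proof (rule sum_norm_diff_projection_le[where b = "\<lambda>i. ?B (w i)"])
    show "orthonormal_family ?I (\<lambda>i. ?B (w i))"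
      using orthonormal_family_subset[OF energy_root_ritz_orthonormal, of ?I] k by auto
    show "\<forall>l\<in>?J. p l \<in> span ((\<lambda>i. ?B (u' i)) ` ?I)"
      unfolding BX p_def using proj_A_in[OF subspace_span] by blast
    show "\<forall>l\<in>?J. \<forall>s\<in>span ((\<lambda>i. ?B (u' i)) ` ?I). (e l - p l) \<bullet> s = 0"
    proof (unfold BX, intro ballI)
      fix l s assume l: "l \<in> ?J" and "s \<in> ?B ` ?X"
      then obtain y where y: "y \<in> ?X" "s = ?B y" by blast
      show "(e l - p l) \<bullet> s = 0"
        using proj_A_orthogonal[OF subspace_span y(1), of "?v l"]
          energy_root_energy_eigenvector[OF l]
        by (simp add: p_def y(2) inner_diff_left energy_root_inner
            flip: energy_root_energy_eigenvector[OF l])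
    qed
  qed (use orthonormal bi IJ in auto)
  also have "\<dots> \<le> (\<Sum>l\<in>?J-?I. \<Sum>i\<in>?I. rlam k / lam (k + 1) * (scaled_ritz i \<bullet> e l)\<^sup>2)"
  proof (intro sum_mono)
    fix l i assume l': "l \<in> ?J - ?I" and i: "i \<in> ?I"
    then have l: "l \<in> ?J" by blast
    have ll: "0 < lam (k + 1)" "lam (k + 1) \<le> lam l"
      using lam_pos[of "k + 1"] mono_onD[OF mono, of "k + 1" l] l' k n by auto
    have rr: "0 < rlam i" "rlam i \<le> rlam k"
      using rlam_pos[OF Ir[OF i]] rlam_mono[OF Ir[OF i], of k] i k by auto
    have "lam l * (u' i \<bullet> e l) = rlam i * (w i \<bullet> e l)"
      using inner_symmetric_matrix[OF symmetric_A, of "u' i" "e l"] eigen[OF l] u'[OF i] by simp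
    then have ue: "u' i \<bullet> e l = rlam i * (w i \<bullet> e l) / lam l" using ll by (simp add: field_simps)
    have "(?B (u' i) \<bullet> e l)\<^sup>2 = lam l * (u' i \<bullet> e l)\<^sup>2"
      using ll by (simp add: energy_root_inner_basis[OF l] power_mult_distrib)
    also have "\<dots> = rlam i / lam l * (scaled_ritz i \<bullet> e l)\<^sup>2"
      unfolding inner_commute[of "scaled_ritz i"] inner_scaled_ritz_square[OF Ir[OF i]] ue
      using ll by (simp add: inner_commute[of "e l"] power2_eq_square)
    also have "\<dots> \<le> rlam k / lam (k + 1) * (scaled_ritz i \<bullet> e l)\<^sup>2"
      using ll rr by (intro mult_right_mono frac_le) auto
    finally show "(?B (u' i) \<bullet> e l)\<^sup>2 \<le> rlam k / lam (k + 1) * (scaled_ritz i \<bullet> e l)\<^sup>2" .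
  qed
  also have "\<dots> = rlam k / lam (k + 1) * (\<Sum>l\<in>?J-?I. \<Sum>i\<in>?I. (scaled_ritz i \<bullet> e l)\<^sup>2)"
    by (simp add: sum_distrib_left)
  also have "(\<Sum>l\<in>?J-?I. \<Sum>i\<in>?I. (scaled_ritz i \<bullet> e l)\<^sup>2)
      = (\<Sum>l\<in>?I. 1 - (\<Sum>i\<in>?I. (scaled_ritz i \<bullet> e l)\<^sup>2))"
  proof (rule sum_complement_orthonormal[OF _ orthonormal _ _ IJ])
    show "orthonormal_family ?I scaled_ritz"
      by (rule orthonormal_family_subset[OF scaled_ritz_orthonormal]) (use k in auto)
  qed simp_all
  also have "rlam k / lam (k + 1) * \<dots>
      \<le> rlam k / lam (k + 1) * (\<Sum>l\<in>?I. lam l * (norm (?v l - ritz_truncation k (?v l)))\<^sup>2)"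
  proof (cases "k = 0")
    case False
    have "0 \<le> rlam k / lam (k + 1)"
      using rlam_pos[of k] lam_pos[of "k + 1"] k n False by (auto intro!: divide_nonneg_nonneg less_imp_le)
    moreover have "1 - (\<Sum>i\<in>?I. (scaled_ritz i \<bullet> e l)\<^sup>2)
        \<le> lam l * (norm (?v l - ritz_truncation k (?v l)))\<^sup>2" if l: "l \<in> ?I" for l
    proof -
      have lJ: "l \<in> ?J" using l IJ by blast
      let ?c = "\<lambda>i. sqrt (lam l) * ip_A A (?v l) (w i) / sqrt (rlam i)"
      have "sqrt (lam l) *\<^sub>R ritz_truncation k (?v l) = (\<Sum>i\<in>?I. ?c i *\<^sub>R scaled_ritz i)"
        unfolding ritz_truncation_def scaleR_sum_right
        by (rule sum.cong[OF refl]) (use rlam_pos[OF Ir] in \<open>force simp: scaled_ritz_def\<close>)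
      moreover have "sqrt (lam l) *\<^sub>R ?v l = e l"
        using lam_pos[OF lJ] by (simp add: energy_eigenvector_def)
      ultimately have eq: "sqrt (lam l) *\<^sub>R (?v l - ritz_truncation k (?v l))
          = e l - (\<Sum>i\<in>?I. ?c i *\<^sub>R scaled_ritz i)"
        by (simp add: scaleR_diff_right)
      have orth: "orthonormal_family ?I scaled_ritz"
        by (rule orthonormal_family_subset[OF scaled_ritz_orthonormal]) (use k in auto)
      have "1 - (\<Sum>i\<in>?I. (scaled_ritz i \<bullet> e l)\<^sup>2)
          \<le> (norm (e l - (\<Sum>i\<in>?I. ?c i *\<^sub>R scaled_ritz i)))\<^sup>2"
        using orthonormal_familyD[OF orthonormal lJ lJ]
        by (subst norm_diff_orthonormal_sum[OF _ orth])
          (simp_all add: power2_norm_eq_inner inner_commute sum_nonneg)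
      also have "\<dots> = lam l * (norm (?v l - ritz_truncation k (?v l)))\<^sup>2"
        unfolding eq[symmetric] using lam_pos[OF lJ] by (simp add: power_mult_distrib)
      finally show ?thesis .
    qed
    ultimately show ?thesis by (intro mult_left_mono sum_mono) auto
  qed simp
  finally have main: "(\<Sum>l\<in>?I. (norm (e l - p l))\<^sup>2)
      \<le> rlam k / lam (k + 1) * (\<Sum>l\<in>?I. lam l * (norm (?v l - ritz_truncation k (?v l)))\<^sup>2)" .
  have "norm_A A (?v l - proj_A A ?X (?v l)) = norm (e l - p l)" if "l \<in> ?I" for l
    using energy_root_energy_eigenvector[of l] that IJ
    by (simp add: p_def linear_diff[OF linear_energy_root] subset_iff flip: norm_energy_root)
  then show ?thesis using main by simp
qed

end

theorem theorem4p1: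
  fixes A :: "real^'n^'n"
    and lam rlam mu rmu :: "nat \<Rightarrow> real"
    and K W :: "(real^'n) set"
    and u w u' :: "nat \<Rightarrow> real^'n"
    and k m :: nat
  assumes "spd A"
    and "ordered_eigenvalues A lam"
    and "subspace K"
    and "1 \<le> k"
    and "inverse_power_step A K k u rlam w u'"
    and "W = aug_space K k u"
    and "m = dim W"
    and "k < m"
    and "\<forall>i\<in>{1..m}. mu i = 1 / lam i"
    and "\<forall>i\<in>{1..m}. rmu i = 1 / rlam i"
    and "\<forall>i\<in>{1..k}. 0 < gap mu rmu m k i"
  shows "\<exists>v :: nat \<Rightarrow> real^'n.
      (\<forall>i\<in>{1..k}. A *v v i = lam i *\<^sub>R v i) \<and>
      (\<forall>i\<in>{1..k}. \<forall>j\<in>{1..k}. ip_A A (v i) (v j) = (if i = j then 1 else 0)) \<and>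
      sqrt (\<Sum>i = 1..k. (norm_A A (v i - proj_A A (span (u' ` {1..k})) (v i)))\<^sup>2)
        \<le> theta mu rmu m k (eta A W) * sqrt (lam k / lam (k + 1))
           * (sqrt (rlam k) * eta_ki mu rmu m k (eta A W) k)
           * sqrt (\<Sum>i = 1..k. (norm_A A (v i - proj_A A (span (u ` {1..k})) (v i)))\<^sup>2)"
proof -
  have sym: "transpose A = A" using assms(1) by (simp add: spd_def)
  obtain e where e: "orthonormal_family {1..CARD('n)} e"
      "\<And>i. i \<in> {1..CARD('n)} \<Longrightarrow> A *v e i = lam i *\<^sub>R e i"
    using spectral_theorem_ordered_eigenvalues[OF sym assms(2)] by blast
  let ?U = "span (u ` {1..k})"
  have W: "subspace W"
    unfolding assms(6) aug_space_def by (rule subspace_sums[OF assms(3) subspace_span])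
  have UW: "?U \<subseteq> W"
    unfolding assms(6) aug_space_def using subspace_0[OF assms(3)] by force
  interpret ritz_system A lam e W rlam w
    using assms(1,5,6) e W by unfold_locales (simp_all add: inverse_power_step_def)
  have mono: "mono_on {1..CARD('n)} lam" using assms(2) by (simp add: ordered_eigenvalues_def)
  have k: "k < dim W" "1 \<le> k" "k \<in> ritz_index" "k + 1 \<in> ritz_index"
    using assms(4,7,8) by auto
  have n: "dim W \<le> CARD('n)" using dim_subset_UNIV[of W] by simp
  have u': "A *v u' i = rlam i *\<^sub>R w i" if "i \<in> {1..k}" for i
    using assms(5) that by (simp add: inverse_power_step_def)
  have lpos: "0 < lam i" if "i \<in> ritz_index" for i using lam_pos[of i] that n by auto
  have rk1: "rmu (k + 1) = 1 / rlam (k + 1)" using assms(7,10) k(4) by blast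
  let ?v = energy_eigenvector
  define \<delta> where "\<delta> = gap mu rmu m k k"
  define h where "h = eta_ki mu rmu m k (eta A W) k"
  define S where "S = (\<Sum>i = 1..k. (norm_A A (?v i - proj_A A ?U (?v i)))\<^sup>2)"
  have \<delta>: "0 < \<delta>" using assms(11) k(2) by (simp add: \<delta>_def)
  have h_def': "h = (1 + (1 / rlam (k + 1)) / \<delta>) * eta A W"
    by (simp only: h_def eta_ki_def \<delta>_def rk1)
  have h: "0 \<le> h"
    unfolding h_def' using eta_nonneg[OF W] rlam_pos[OF k(4)] \<delta> by simp
  \<comment> \<open>Every Ritz value after the \<open>k\<close>-th is at least \<open>lam k\<close>, so
    \<open>1 / rlam j \<le> 1 / lam k \<le> 1 / lam i\<close> and the gap at \<open>k\<close> is the smallest one.\<close>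
  have gap: "\<delta> \<le> \<bar>1 / rlam j - 1 / lam i\<bar>" if i: "i \<in> {1..k}" and j: "j \<in> {k<..dim W}" for i j
  proof -
    have "\<delta> \<le> \<bar>rmu j - mu k\<bar>"
      unfolding \<delta>_def gap_def using j assms(7) by (intro Min_le) auto
    also have "\<dots> = \<bar>1 / rlam j - 1 / lam k\<bar>" using assms(7,9,10) j k(3) by simp
    finally have "\<delta> \<le> \<bar>1 / rlam j - 1 / lam k\<bar>" .
    moreover have "1 / rlam j \<le> 1 / lam k"
    proof -
      have "lam k \<le> lam (k + 1)" using mono_onD[OF mono, of k "k + 1"] k n by auto
      also have "\<dots> \<le> rlam (k + 1)" by (rule ritz_value_ge[OF mono k(1)])
      also have "\<dots> \<le> rlam j" using rlam_mono[OF k(4), of j] j by auto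
      finally show ?thesis using lpos[OF k(3)] by (simp add: frac_le)
    qed
    moreover have "1 / lam k \<le> 1 / lam i"
      using mono_onD[OF mono, of i k] lpos[of i] i k n by (auto intro!: divide_left_mono)
    ultimately show ?thesis by linarith
  qed
  \<comment> \<open>Truncation error, then duality, then the best approximation in \<open>W\<close> compared with the one in the
    old span.\<close>
  have bound: "norm (?v i - ritz_truncation k (?v i)) \<le> h * norm_A A (?v i - proj_A A ?U (?v i))"
    if i: "i \<in> {1..k}" for i
  proof -
    have iJ: "i \<in> {1..CARD('n)}" using i k n by auto
    have "norm (?v i - ritz_truncation k (?v i))
        \<le> (1 + (1 / rlam (k + 1)) / \<delta>) * norm (?v i - proj_A A W (?v i))"
      by (rule norm_diff_ritz_truncation_le[OF energy_eigenvector_eigen[OF iJ] lam_pos[OF iJ] k(1) \<delta>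
            gap[OF i]])
    also have "\<dots> \<le> (1 + (1 / rlam (k + 1)) / \<delta>)
        * (eta A W * norm_A A (?v i - proj_A A W (?v i)))"
      using rlam_pos[OF k(4)] \<delta> by (intro mult_left_mono Aubin_Nitsche W) auto
    also have "\<dots> = h * norm_A A (?v i - proj_A A W (?v i))" by (simp add: h_def')
    also have "\<dots> \<le> h * norm_A A (?v i - proj_A A ?U (?v i))"
      using proj_A_in[OF subspace_span, of "u ` {1..k}" "?v i"] UW
      by (intro mult_left_mono proj_A_best_approximation W h) blast
    finally show ?thesis .
  qed
  have pos: "0 < lam k" "0 < lam (k + 1)" "0 < rlam k"
    using lpos[OF k(3)] lpos[OF k(4)] rlam_pos[OF k(3)] by auto
  have "(\<Sum>i = 1..k. (norm_A A (?v i - proj_A A (span (u' ` {1..k})) (?v i)))\<^sup>2)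
      \<le> rlam k / lam (k + 1)
        * (\<Sum>i = 1..k. lam i * (norm (?v i - ritz_truncation k (?v i)))\<^sup>2)"
    by (rule inverse_power_output_error[OF mono k(1) u'])
  also have "\<dots> \<le> rlam k / lam (k + 1)
        * (\<Sum>i = 1..k. lam k * (h * norm_A A (?v i - proj_A A ?U (?v i)))\<^sup>2)"
  proof (intro mult_left_mono sum_mono mult_mono power_mono bound)
    fix i assume i: "i \<in> {1..k}"
    show "lam i \<le> lam k" using mono_onD[OF mono, of i k] i k n by auto
  qed (use pos in auto)
  also have "\<dots> = lam k / lam (k + 1) * (rlam k * h\<^sup>2) * S"
    by (simp add: S_def power_mult_distrib mult_ac flip: sum_distrib_left)
  finally have "sqrt (\<Sum>i = 1..k. (norm_A A (?v i - proj_A A (span (u' ` {1..k})) (?v i)))\<^sup>2)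
      \<le> sqrt (lam k / lam (k + 1) * (rlam k * h\<^sup>2) * S)" by (rule real_sqrt_le_mono)
  also have "\<dots> = sqrt (lam k / lam (k + 1)) * (sqrt (rlam k) * h) * sqrt S"
    using h by (simp only: real_sqrt_mult) simp
  also have "\<dots> \<le> theta mu rmu m k (eta A W)
      * (sqrt (lam k / lam (k + 1)) * (sqrt (rlam k) * h) * sqrt S)"
  proof -
    \<comment> \<open>The term added to 1 under the root is nonnegative.\<close>
    have "1 \<le> theta mu rmu m k (eta A W)"
      unfolding theta_def rk1 using rlam_pos[OF k(4)] by simp
    moreover have "0 \<le> sqrt (lam k / lam (k + 1)) * (sqrt (rlam k) * h) * sqrt S"
      using pos h by (simp add: S_def sum_nonneg)
    ultimately show ?thesis by (metis mult_1 mult_right_mono)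
  qed
  finally have "sqrt (\<Sum>i = 1..k. (norm_A A (?v i - proj_A A (span (u' ` {1..k})) (?v i)))\<^sup>2)
      \<le> theta mu rmu m k (eta A W) * sqrt (lam k / lam (k + 1))
        * (sqrt (rlam k) * eta_ki mu rmu m k (eta A W) k) * sqrt S"
    by (simp add: h_def mult.assoc)
  moreover have "\<forall>i\<in>{1..k}. A *v ?v i = lam i *\<^sub>R ?v i"
    using energy_eigenvector_eigen k n by auto
  moreover have "\<forall>i\<in>{1..k}. \<forall>j\<in>{1..k}. ip_A A (?v i) (?v j) = (if i = j then 1 else 0)"
    using energy_eigenvector_orthonormal k n by auto
  ultimately show ?thesis unfolding S_def by blast
qed

end
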